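(* For every ordinal $\alpha$, $\mathbf{o}(\Phi_\alpha)=\mathbf{w}(\Phi_\alpha)=\alpha$. Moreover, if $\alpha$ is infinite then $\mathbf{w}(\mathcal{P}_f(\Phi_\alpha))=\mathbf{o}(\mathcal{P}_f(\Phi_\alpha))=2^\alpha$, and if $\alpha=k<\omega$ then $\mathbf{o}(\mathcal{P}_f(\Phi_k))=2^k$ and $\mathbf{w}(\mathcal{P}_f(\Phi_k))=\mathbf{w}(\mathcal{P}_f(\Gamma_k))$.
   Context: A wqo is a quasi-order in which every infinite sequence has $i<j$ with $x_i\le x_j$. $\mathbf{o}(A),\mathbf{h}(A),\mathbf{w}(A)$ are the ranks of the roots of the well-founded trees of finite bad sequences, finite strictly decreasing sequences, and finite sequences of pairwise incomparable elements of $A$ (root: empty sequence, children: one-element extensions; rank $r(s)=\sup\{r(t)+1: t\text{ child of } s\}$). $\mathcal{P}_f(A)$ is the set of finite subsets of $A$ with the Hoare embedding: $S\le_H S'$ iff $\forall a\in S\,\exists b\in S'\; a\le b$. $\Gamma_k$ is a $k$-element antichain. For an ordinal-indexed family $(A_\gamma)_{\gamma<\delta}$ of wqos, the lexicographic sum $\sum_{\gamma<\delta}A_\gamma$ is their disjoint union where $x\le y$ iff either $x,y\in A_\gamma$ with $x\le_{A_\gamma} y$, or $x\in A_\gamma,y\in A_{\gamma'}$ with $\gamma<\gamma'$. The lexicographic product $A\cdot B$ is $A\times B$ with $(a,b)\le(a',b')$ iff $b\le_B b'$ and ($b\equiv_B b'$ implies $a\le_A a'$); $A_1\cdots A_n$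 is iterated. $A\sqcup B$ is the disjoint union with ordering $\le_A\cup\le_B$. Define: $\Phi_{\omega^0}=\Gamma_1$; $\Phi_{\omega^1}=\sum_{n<\omega}\Gamma_n$; for $\alpha>0$, $\Phi_{\omega^{\omega^\alpha}}=\sum_{\beta<\omega^\alpha}\Phi_{\omega^\beta}$; if $\alpha=\omega^{\alpha_1}+\dots+\omega^{\alpha_n}$ in Cantor normal form with $n>1$, $\Phi_{\omega^\alpha}=\Phi_{\omega^{\omega^{\alpha_1}}}\cdots\Phi_{\omega^{\omega^{\alpha_n}}}$ (lexicographic product). Finally, for an arbitrary ordinal $\alpha=\omega^{\alpha_1}+\dots+\omega^{\alpha_n}$ in Cantor normal form, $\Phi_\alpha=\Phi_{\omega^{\alpha_1}}\sqcup\dots\sqcup\Phi_{\omega^{\alpha_n}}$ (and $\Phi_0=\emptyset$). *)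

theory Defs
  imports Main
begin

text \<open>An ordinal alpha is represented by an element a of a well-ordered type:
  alpha is the order type of the initial segment below a.\<close>

definition ordR :: "'a::wellorder \<Rightarrow> 'a rel" where
  "ordR a = {(u, v). u \<le> v \<and> v < a}"

definition fsupp :: "'a::wellorder \<Rightarrow> ('a \<Rightarrow> nat) \<Rightarrow> bool" where
  "fsupp e f \<longleftrightarrow> finite {z. f z \<noteq> 0} \<and> (\<forall>z. f z \<noteq> 0 \<longrightarrow> z < e)"

definition omegapow :: "'a::wellorder \<Rightarrow> ('a \<Rightarrow> nat) rel" where
  "omegapow e = {(f, g). fsupp e f \<and> fsupp e g \<and>
      (f = g \<or> f (Max {z. f z \<noteq> g z}) < g (Max {z. f z \<noteq> g z}))}"

definition twopow :: "'a::wellorder \<Rightarrow> 'a set rel" where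
  "twopow a = {(S, T). finite S \<and> S \<subseteq> {z. z < a} \<and> finite T \<and> T \<subseteq> {z. z < a} \<and>
      (S = T \<or> Max ((S - T) \<union> (T - S)) \<in> T)}"

definition osum_list :: "'c rel list \<Rightarrow> (nat \<times> 'c) rel" where
  "osum_list Rs = {((i, x), (j, y)). i < length Rs \<and> j < length Rs \<and>
      x \<in> Field (Rs ! i) \<and> y \<in> Field (Rs ! j) \<and> (i < j \<or> (i = j \<and> (x, y) \<in> Rs ! i))}"

definition is_cnf :: "'a::wellorder \<Rightarrow> 'a list \<Rightarrow> bool" where
  "is_cnf a es \<longleftrightarrow> (\<forall>i j. i < j \<and> j < length es \<longrightarrow> es ! j \<le> es ! i) \<and>
      (ordR a, osum_list (map omegapow es)) \<in> ordIso"

definition cnf :: "'a::wellorder \<Rightarrow> 'a list" where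
  "cnf a = (SOME es. is_cnf a es)"

definition elem_of :: "'c rel \<Rightarrow> 'a::wellorder \<Rightarrow> 'a" where
  "elem_of R g = (THE y. y < g \<and> (ordR y, R) \<in> ordIso)"

type_synonym 'x qo = "'x set \<times> ('x \<Rightarrow> 'x \<Rightarrow> bool)"

datatype 'a phi = Om nat nat | Sm 'a "'a phi" | Pr "'a phi list" | Dj nat "'a phi"

definition gamma :: "nat \<Rightarrow> 'a phi qo" where
  "gamma k = ({Om k i | i. i < k}, \<lambda>x y. x = y)"

text \<open>Phi_omega = lexicographic sum over n < omega of Gamma_n (written out).\<close>
definition phi_omega :: "'a phi qo" where
  "phi_omega = ({Om n i | n i. i < n},
     \<lambda>u v. case (u, v) of (Om n i, Om m j) \<Rightarrow> n < m \<or> (n = m \<and> i = j) | _ \<Rightarrow> False)"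

definition lexsum :: "'a::wellorder set \<Rightarrow> ('a \<Rightarrow> 'a phi qo) \<Rightarrow> 'a phi qo" where
  "lexsum I F = ({Sm b x | b x. b \<in> I \<and> x \<in> fst (F b)},
     \<lambda>u v. case (u, v) of (Sm b x, Sm c y) \<Rightarrow> b < c \<or> (b = c \<and> snd (F b) x y) | _ \<Rightarrow> False)"

text \<open>Lexicographic product A1 ... An: the last factor is the most significant;
  lexrev works on reversed lists (head most significant).\<close>
fun lexrev :: "'x qo list \<Rightarrow> 'x list \<Rightarrow> 'x list \<Rightarrow> bool" where
  "lexrev (A # As) (x # xs) (y # ys) = (snd A x y \<and> (snd A y x \<longrightarrow> lexrev As xs ys))"
| "lexrev _ _ _ = True"

definition lexprod :: "'a phi qo list \<Rightarrow> 'a phi qo" where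
  "lexprod As = ({Pr xs | xs. length xs = length As \<and> (\<forall>i < length As. xs ! i \<in> fst (As ! i))},
     \<lambda>u v. case (u, v) of (Pr xs, Pr ys) \<Rightarrow> lexrev (rev As) (rev xs) (rev ys) | _ \<Rightarrow> False)"

definition dunion :: "'a phi qo list \<Rightarrow> 'a phi qo" where
  "dunion As = ({Dj i x | i x. i < length As \<and> x \<in> fst (As ! i)},
     \<lambda>u v. case (u, v) of (Dj i x, Dj j y) \<Rightarrow> i = j \<and> snd (As ! i) x y | _ \<Rightarrow> False)"

text \<open>phiw g = Phi_{omega^(ordinal of g)}, by well-founded recursion on g.\<close>
definition phiw_step :: "('a::wellorder \<Rightarrow> 'a phi qo) \<Rightarrow> 'a \<Rightarrow> 'a phi qo" where
  "phiw_step rec g = (let es = cnf g in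
     if es = [] then gamma 1
     else if length es = 1 then
       (if (\<forall>z. \<not> z < hd es) then phi_omega else lexsum {b. b < g} rec)
     else lexprod (map (\<lambda>e. rec (elem_of (omegapow e) g)) es))"

definition phiw :: "'a::wellorder \<Rightarrow> 'a phi qo" where
  "phiw = wfrec {(x, y). x < y} phiw_step"

definition Phi :: "'a::wellorder \<Rightarrow> 'a phi qo" where
  "Phi a = dunion (map phiw (cnf a))"

definition Pf :: "'x qo \<Rightarrow> 'x set qo" where
  "Pf A = ({S. finite S \<and> S \<subseteq> fst A}, \<lambda>S T. \<forall>x\<in>S. \<exists>y\<in>T. snd A x y)"

definition bad_seqs :: "'x qo \<Rightarrow> 'x list set" where
  "bad_seqs A = {xs. set xs \<subseteq> fst A \<and>
      \<not> (\<exists>i j. i < j \<and> j < length xs \<and> snd A (xs ! i) (xs ! j))}"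

definition antichain_seqs :: "'x qo \<Rightarrow> 'x list set" where
  "antichain_seqs A = {xs. set xs \<subseteq> fst A \<and>
      (\<forall>i j. i < length xs \<and> j < length xs \<and> i \<noteq> j \<longrightarrow> \<not> snd A (xs ! i) (xs ! j))}"

text \<open>Ordinals below-or-equal to the order type of r: Some x (x in Field r) and
  None standing for the order type of r itself.\<close>
fun evalid :: "'b rel \<Rightarrow> 'b option \<Rightarrow> bool" where
  "evalid r None = True"
| "evalid r (Some x) = (x \<in> Field r)"

fun eless :: "'b rel \<Rightarrow> 'b option \<Rightarrow> 'b option \<Rightarrow> bool" where
  "eless r (Some x) None = (x \<in> Field r)"
| "eless r (Some x) (Some y) = ((x, y) \<in> r \<and> x \<noteq> y)"
| "eless r None _ = False"

definition is_lsub :: "'b rel \<Rightarrow> 'b option set \<Rightarrow> 'b option \<Rightarrow> bool" where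
  "is_lsub r S u \<longleftrightarrow> evalid r u \<and> (\<forall>v\<in>S. eless r v u) \<and>
     (\<forall>u'. evalid r u' \<and> (\<forall>v\<in>S. eless r v u') \<longrightarrow> \<not> eless r u' u)"

definition rank_is :: "'x list set \<Rightarrow> 'b rel \<Rightarrow> bool" where
  "rank_is N r \<longleftrightarrow> Well_order r \<and>
     wf {(t, s). s \<in> N \<and> t \<in> N \<and> (\<exists>x. t = s @ [x])} \<and>
     (\<exists>\<rho>. \<rho> [] = None \<and>
        (\<forall>s\<in>N. is_lsub r {\<rho> t | t. t \<in> N \<and> (\<exists>x. t = s @ [x])} (\<rho> s)))"

end

theory Submission
  imports Defs "HOL-Library.Multiset_Order"
begin

text \<open>
  Ordinals are represented by (nested) multisets over well-orders: under the multiset order,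
  \<open>{#e\<^sub>1, ..., e\<^sub>n#}\<close> with \<open>e\<^sub>1 \<ge> ... \<ge> e\<^sub>n\<close> is \<open>\<omega>^e\<^sub>1 + ... + \<omega>^e\<^sub>n\<close> and \<open>+\<close> is the natural sum.

  Upper bounds. Residuals of unions, lexicographic sums and products are bounded by natural sums.
  For finite subsets, the residual of \<open>S\<close> is the union over \<open>s \<in> S\<close> of the finite subsets of
  \<open>{y. \<not> s \<le> y}\<close>, which suffices when the bound is a limit; when it is a successor
  \<open>\<beta> + 1\<close> but not \<open>\<beta>\<close>, some maximal element can be removed to reach \<open>\<beta>\<close>, and removing
  one element halves the powerset.

  Lower bounds. Antichains of \<open>Q \<times> P\<close> contain those of the lexicographic product with \<open>P\<close> more
  significant, so \<open>w(Q \<times> P) \<ge> w(Q) w(P)\<close>. Since the finite subsets of a disjoint union are a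
  product, this gives \<open>2^(\<beta> + \<gamma>) = 2^\<beta> 2^\<gamma>\<close> for widths as long as \<open>\<beta>\<close>, \<open>\<gamma>\<close> are limits. A finite
  tail \<open>k\<close> of \<open>\<alpha>\<close> contributes a finite Boolean lattice, whose own width is too small. It is
  handled by running through the lattice from the top, which works because the infinite part keeps
  its full width after deleting everything below finitely many elements.
\<close>

section \<open>Ordinal arithmetic on multisets\<close>

text \<open>An antichain sequence is a bad sequence, so w \<le> o. Hence \<open>rank_le\<close> for
  \<open>bad\<close> and \<open>rank_ge\<close> for \<open>inc\<close> with the same bound settle
  both ranks at once. Only for finite \<alpha>, where the finite subsets may have smaller width, is
  a lower bound for \<open>bad\<close> proved separately.

  The ordinals involved may exceed the order type of 'a; multisets give room and stay well-ordered,
  each nesting being one use of \<omega>^x. The first level is the normal form of \<alpha>. The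
  second makes exponents themselves sums, since products of powers of \<omega> add exponents. The
  third is forced by 2^(\<omega>^f) = \<omega>^(\<omega>^(-1+f)), which moves a sum in \<alpha> into
  an exponent.

  Multiset sum is natural sum, whereas lexicographic products and 2^\<alpha> follow ordinary
  arithmetic. Both agree when terms are appended in decreasing order. This is the origin of side
  conditions such as \<open>\<forall>x\<in>#G. e \<le> x\<close> and
  \<open>N \<le> {#{#e#}#}\<close>, which normal forms satisfy.\<close>

lemma finite_count_less: "finite {x. count K x < count M x}"
  by (rule finite_subset[of _ "set_mset M"]) (auto intro: ccontr simp: not_in_iff)

lemma count_less_imp_in: "count K x < count M x \<Longrightarrow> x \<in># M"
  by (auto intro: ccontr simp: not_in_iff)

text \<open>Compare at the largest x where \<open>K\<close> falls short of \<open>M + N\<close>. In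
  the summand containing x, one copy of x is exchanged for the part of \<open>K\<close> below x;
  above x the counts agree, so the result still dominates \<open>K\<close>. Thus
  \<open>M + N\<close> is the least value above all M' + N and M + N'.\<close>

lemma less_add_mset_cases:
  fixes K M N :: "'b::wellorder multiset"
  assumes "K < M + N"
  shows "(\<exists>M'<M. K \<le> M' + N) \<or> (\<exists>N'<N. K \<le> M + N')"
proof -
  have ex: "\<exists>A'<A. K \<le> A' + B"
    if K: "K < A + B" and x: "count K x < count (A + B) x" "x \<in># A"
      and max: "\<And>y. y > x \<Longrightarrow> count (A + B) y \<le> count K y"
    for x :: 'b and A B
  proof -
    let ?L = "filter_mset (\<lambda>y. y < x) K"
    let ?A' = "(A - {#x#}) + ?L"
    have "?L < {#x#}" by simp
    then have "?A' < (A - {#x#}) + {#x#}" by (rule add_strict_left_mono)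
    then have less: "?A' < A" using x by simp
    have eq: "count K y \<le> count (A + B) y" if "y > x" for y
    proof (rule ccontr)
      assume "\<not> ?thesis"
      then obtain z where "z > y" "count K z < count (A + B) z"
        using K unfolding less_multiset\<^sub>H\<^sub>O by (meson not_le)
      with max[of z] that show False by (meson leD less_trans)
    qed
    have "count K y \<le> count (?A' + B) y" for y
      using eq[of y] max[of y] x by (cases y x rule: linorder_cases) auto
    then have "K \<subseteq># ?A' + B" by (simp add: subseteq_mset_def)
    then show ?thesis using less subset_eq_imp_le_multiset by blast
  qed
  let ?S = "{x. count K x < count (M + N) x}"
  have "finite ?S" by (rule finite_count_less)
  moreover have "?S \<noteq> {}" using lt_imp_ex_count_lt[OF assms] by auto
  ultimately obtain x where x: "x \<in> ?S" and max: "\<And>y. y > x \<Longrightarrow> y \<notin> ?S"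
    by (meson Max_in Max_ge not_le)
  have "x \<in># M + N" using x count_less_imp_in[of K x "M + N"] by blast
  then consider "x \<in># M" | "x \<in># N" by auto
  then show ?thesis
  proof cases
    case 1
    from ex[OF assms _ this] x max show ?thesis by (auto simp: not_less)
  next
    case 2
    have "K < N + M" using assms by (simp add: add.commute)
    from ex[OF this _ 2] x max show ?thesis by (auto simp: not_less add.commute)
  qed
qed

text \<open>Everything in the interval [G, G + \<omega>^e) has the normal form of \<open>G\<close>
  as its initial part. A topmost deficit y of x would be outweighed by a surplus z > y, and the
  upper bound on x would force a deficit w > z; as w > e, this is a deficit against \<open>G\<close>
  itself, contradicting the choice of y.\<close>

lemma between_imp_subseteq:
  fixes G :: "'b::wellorder multiset"
  assumes le: "G \<le> x" and less: "x < G + {#e#}" and e: "\<forall>y\<in>#G. e \<le> y"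
  shows "G \<subseteq># x"
proof (rule ccontr)
  assume nsub: "\<not> ?thesis"
  let ?S = "{y. count x y < count G y}"
  have fin: "finite ?S" by (rule finite_count_less)
  moreover have "?S \<noteq> {}" using nsub by (auto simp: subseteq_mset_def not_le)
  ultimately obtain y where y: "y \<in> ?S" and max: "\<And>z. z > y \<Longrightarrow> z \<notin> ?S"
    by (meson Max_in Max_ge not_le)
  have "y \<in># G" using y by (auto intro: count_less_imp_in)
  then have "e \<le> y" using e by blast
  have "G \<noteq> x" using y by auto
  then have "G < x" using le by simp
  then obtain z where z: "z > y" "count G z < count x z"
    using y unfolding less_multiset\<^sub>H\<^sub>O by blast
  then have "count (G + {#e#}) z < count x z" using \<open>e \<le> y\<close> by auto
  then obtain w where w: "w > z" "count x w < count (G + {#e#}) w"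
    using less unfolding less_multiset\<^sub>H\<^sub>O by blast
  have "e < w" using w(1) z(1) \<open>e \<le> y\<close> by simp
  then have "count x w < count G w" using w(2) by (auto split: if_splits)
  moreover have "y < w" using w(1) z(1) by simp
  ultimately show False using max[of w] by simp
qed

text \<open>Here \<open>G + K\<close> is the ordinary sum, so an ordinal below it lies below
  \<open>G\<close> or in the copy of \<open>K\<close> appended to \<open>G\<close>.\<close>

lemma less_add_le_single_cases:
  fixes L :: "'b::wellorder multiset"
  assumes "L < G + K" "K \<le> {#e#}" "\<forall>y\<in>#G. e \<le> y"
  shows "L < G \<or> (\<exists>K'<K. L = G + K')"
proof (cases "L < G")
  case False
  have "L < G + {#e#}" using assms(1,2) by (meson add_left_mono less_le_trans)
  then have "G \<subseteq># L" using between_imp_subseteq[of G L e] False assms(3) by auto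
  then obtain K' where "L = G + K'" by (auto simp: subset_mset.le_iff_add)
  then show ?thesis using assms(1) by auto
qed simp

text \<open>\<open>A\<close> and \<open>B\<close> are multiples of \<omega>^c, so their difference
  cannot be made up by anything below \<omega>^c.\<close>

lemma image_mset_add_less:
  fixes A B K :: "'b::wellorder multiset"
  assumes "A < B" "\<forall>x\<in>#A. c \<le> x" "\<forall>x\<in>#B. c \<le> x" "K < {#c#}"
  shows "A + K < B"
proof -
  have K: "count K y = 0" if "c \<le> y" for y using assms(4) that by (auto simp: count_eq_zero_iff)
  have A: "count A y = 0" if "y < c" for y using assms(2) that by (auto simp: count_eq_zero_iff)
  have B: "count B y = 0" if "y < c" for y using assms(3) that by (auto simp: count_eq_zero_iff)
  obtain x where x: "count A x < count B x" using lt_imp_ex_count_lt[OF assms(1)] by auto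
  have cx: "c \<le> x" using x B by (metis not_le not_less_zero)
  have "A + K \<noteq> B" using x K[OF cx] by auto
  moreover have "\<exists>x>y. count (A + K) x < count B x" if y: "count B y < count (A + K) y" for y
  proof (cases "y < c")
    case True
    then have "x > y" using cx by simp
    then show ?thesis using x K[OF cx] by (intro exI[of _ x]) simp
  next
    case False
    then have "count B y < count A y" using K[of y] y by auto
    then obtain z where "z > y" "count A z < count B z"
      using assms(1) unfolding less_multiset\<^sub>H\<^sub>O by blast
    then show ?thesis using K[of z] False by auto
  qed
  ultimately show ?thesis unfolding less_multiset\<^sub>H\<^sub>O by blast
qed

lemma image_mset_less:
  fixes h :: "'b::linorder \<Rightarrow> 'c::linorder"
  assumes "M < N" "\<And>x y. x \<in># M + N \<Longrightarrow> y \<in># M + N \<Longrightarrow> x < y \<Longrightarrow> h x < h y"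
  shows "image_mset h M < image_mset h N"
  by (rule image_mset_strict_mono[OF _ assms(1)]) (use assms(2) in auto)

text \<open>Division with remainder: \<open>image_mset ((+) G) N\<close> is \<omega>^G times
  \<open>N\<close>, because the bounds on \<open>N\<close> and \<open>G\<close> make
  \<open>G + x\<close> the ordinary sum of exponents. The terms of \<open>M\<close> with exponent at
  least \<open>G\<close> form the multiple \<omega>^G N', the others the remainder
  \<open>K\<close>.\<close>

lemma less_image_add_cases:
  fixes G :: "'b::wellorder multiset"
  assumes M: "M < image_mset ((+) G) N" and N: "N \<le> {#{#e#}#}" and G: "\<forall>y\<in>#G. e \<le> y"
  shows "\<exists>N' K. N' < N \<and> K < {#G#} \<and> M = image_mset ((+) G) N' + K"
proof -
  have hmono: "image_mset ((+) G) A \<le> image_mset ((+) G) B \<longleftrightarrow> A \<le> B" for A B :: "'b multiset multiset"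
    using image_mset_less[of A B "(+) G"] image_mset_less[of B A "(+) G"]
    by (cases A B rule: linorder_cases) (auto simp: less_le_not_le)
  have "M < {#G + {#e#}#}"
  proof -
    have "image_mset ((+) G) N \<le> image_mset ((+) G) {#{#e#}#}" using hmono N by blast
    also have "\<dots> = {#G + {#e#}#}" by simp
    finally show ?thesis using M by (rule less_le_trans[rotated])
  qed
  then have ub: "x < G + {#e#}" if "x \<in># M" for x using that by simp
  define U where "U = filter_mset (\<lambda>x. G \<le> x) M"
  define K where "K = filter_mset (\<lambda>x. \<not> G \<le> x) M"
  have MUK: "M = U + K" by (simp add: U_def K_def)
  define N' where "N' = image_mset (\<lambda>x. x - G) U"
  have "image_mset ((+) G) N' = image_mset (\<lambda>x. x) U"
    unfolding N'_def multiset.map_comp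
    by (rule image_mset_cong)
      (use between_imp_subseteq[of G _ e] ub G in \<open>auto simp: U_def o_def\<close>)
  then have U: "U = image_mset ((+) G) N'" by simp
  have "U \<le> M" by (simp add: U_def subset_eq_imp_le_multiset)
  then have "\<not> N \<le> N'" using M hmono[of N N'] U by auto
  then have "N' < N" by simp
  moreover have "K < {#G#}" by (auto simp: K_def)
  ultimately show ?thesis using MUK U by blast
qed

lemma image_add_less:
  fixes G :: "'b::wellorder multiset"
  assumes "N' < N" "K < {#G#}"
  shows "image_mset ((+) G) N' + K < image_mset ((+) G) N"
proof (rule image_mset_add_less)
  show "image_mset ((+) G) N' < image_mset ((+) G) N"
    by (rule image_mset_less[OF assms(1)]) simp
qed (use assms(2) in \<open>auto simp: subset_eq_imp_le_multiset\<close>)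

section \<open>Bounds on ranks\<close>

text \<open>\<open>R x y\<close> says that \<open>y\<close> may still be played after \<open>x\<close>; the set is the residual of a sequence.\<close>

inductive rank_le :: "('x \<Rightarrow> 'x \<Rightarrow> bool) \<Rightarrow> 'x set \<Rightarrow> 'o::wellorder \<Rightarrow> bool" for R where
  rank_leI: "(\<And>x. x \<in> X \<Longrightarrow> \<exists>M'<M. rank_le R {y \<in> X. R x y} M') \<Longrightarrow> rank_le R X M"

inductive rank_ge :: "('x \<Rightarrow> 'x \<Rightarrow> bool) \<Rightarrow> 'x set \<Rightarrow> 'o::wellorder \<Rightarrow> bool" for R where
  rank_geI: "(\<And>M'. M' < M \<Longrightarrow> \<exists>x\<in>X. rank_ge R {y \<in> X. R x y} M') \<Longrightarrow> rank_ge R X M"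

lemma rank_leD: "rank_le R X M \<Longrightarrow> x \<in> X \<Longrightarrow> \<exists>M'<M. rank_le R {y \<in> X. R x y} M'"
  by (erule rank_le.cases) blast

lemma rank_geD: "rank_ge R X M \<Longrightarrow> M' < M \<Longrightarrow> \<exists>x\<in>X. rank_ge R {y \<in> X. R x y} M'"
  by (erule rank_ge.cases) blast

text \<open>\<open>f\<close> turns a play in \<open>X\<close> into a play in \<open>Y\<close>, so
  upper bounds pull back along it, while in \<open>rank_ge_map\<close> lower bounds push
  forward.\<close>

lemma rank_le_map:
  assumes "rank_le R' Y M" "M \<le> N" "f ` X \<subseteq> Y"
    "\<And>x y. x \<in> X \<Longrightarrow> y \<in> X \<Longrightarrow> R x y \<Longrightarrow> R' (f x) (f y)"
  shows "rank_le R X N"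
  using assms
proof (induction M arbitrary: X Y N rule: less_induct)
  case (less M)
  show ?case
  proof (rule rank_leI)
    fix x assume x: "x \<in> X"
    then obtain M' where M': "M' < M" "rank_le R' {y \<in> Y. R' (f x) y} M'"
      using rank_leD[OF less.prems(1)] less.prems(3) by blast
    have "rank_le R {y \<in> X. R x y} M'"
      by (rule less.IH[OF M']) (use less.prems x in auto)
    then show "\<exists>M'<N. rank_le R {y \<in> X. R x y} M'" using M' less.prems(2) by (meson less_le_trans)
  qed
qed

lemma rank_ge_map:
  assumes "rank_ge R X M" "N \<le> M" "f ` X \<subseteq> Y"
    "\<And>x y. x \<in> X \<Longrightarrow> y \<in> X \<Longrightarrow> R x y \<Longrightarrow> R' (f x) (f y)"
  shows "rank_ge R' Y N"
  using assms
proof (induction M arbitrary: X Y N rule: less_induct)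
  case (less M)
  show ?case
  proof (rule rank_geI)
    fix N' assume N': "N' < N"
    then have "N' < M" using less.prems(2) by simp
    then obtain x where x: "x \<in> X" "rank_ge R {y \<in> X. R x y} N'"
      using rank_geD[OF less.prems(1)] by blast
    have "rank_ge R' {y \<in> Y. R' (f x) y} N'"
      by (rule less.IH[OF \<open>N' < M\<close> x(2)]) (use less.prems x in auto)
    then show "\<exists>y\<in>Y. rank_ge R' {z \<in> Y. R' y z} N'" using x less.prems(3) by blast
  qed
qed

lemma rank_le_mono: "rank_le R Y M \<Longrightarrow> X \<subseteq> Y \<Longrightarrow> M \<le> N \<Longrightarrow> rank_le R X N"
  by (erule rank_le_map[where f = id]) auto

lemma rank_ge_mono: "rank_ge R X M \<Longrightarrow> X \<subseteq> Y \<Longrightarrow> N \<le> M \<Longrightarrow> rank_ge R Y N"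
  by (erule rank_ge_map[where f = id]) auto

lemma rank_ge_rel_mono: "rank_ge R X M \<Longrightarrow> (\<And>x y. R x y \<Longrightarrow> R' x y) \<Longrightarrow> rank_ge R' X M"
  by (erule rank_ge_map[where f = id]) auto

text \<open>If N > M, the lower bound supplies a move whose residual has rank at least
  \<open>M\<close>, whereas every residual has a bound below \<open>M\<close>.\<close>

lemma rank_ge_le: "rank_ge R X N \<Longrightarrow> rank_le R X M \<Longrightarrow> N \<le> M"
proof (induction M arbitrary: X N rule: less_induct)
  case (less M)
  show ?case
  proof (rule ccontr)
    assume "\<not> N \<le> M"
    then obtain x where x: "x \<in> X" "rank_ge R {y \<in> X. R x y} M"
      using rank_geD[OF less.prems(1)] by force
    obtain M' where "M' < M" "rank_le R {y \<in> X. R x y} M'"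
      using rank_leD[OF less.prems(2) x(1)] by blast
    then have "M \<le> M'" using less.IH x(2) by blast
    then show False using \<open>M' < M\<close> by simp
  qed
qed

lemma rank_ge_sup: "(\<And>M'. M' < M \<Longrightarrow> \<exists>N>M'. rank_ge R X N) \<Longrightarrow> rank_ge R X M"
  by (meson rank_geD rank_geI)

lemma rank_le_empty: "rank_le R {} M"
  by (rule rank_leI) simp

lemma rank_ge_empty_iff: "rank_ge R {} M \<longleftrightarrow> (\<forall>N. M \<le> N)"
  by (metis empty_iff not_le rank_geD rank_geI)

text \<open>A move strictly lowers the bound of the part it belongs to, and the natural sum is
  strictly monotone in each argument.\<close>

lemma rank_le_Un:
  fixes M N :: "'b::wellorder multiset"
  assumes "rank_le R X M" "rank_le R Y N"
  shows "rank_le R (X \<union> Y) (M + N)"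
proof -
  have "rank_le R (X \<union> Y) S" if "rank_le R X M" "rank_le R Y N" "S = M + N" for S
    using that
  proof (induction S arbitrary: X Y M N rule: less_induct)
    case (less S)
    show ?case
    proof (rule rank_leI)
      fix x assume x: "x \<in> X \<union> Y"
      have eq: "{y \<in> X \<union> Y. R x y} = {y \<in> X. R x y} \<union> {y \<in> Y. R x y}" by auto
      from x show "\<exists>S'<S. rank_le R {y \<in> X \<union> Y. R x y} S'"
      proof
        assume "x \<in> X"
        then obtain M' where M': "M' < M" "rank_le R {y \<in> X. R x y} M'"
          using rank_leD[OF less.prems(1)] by blast
        then have "M' + N < S" using less.prems by simp
        moreover have "rank_le R {y \<in> Y. R x y} N"
          using less.prems(2) by (rule rank_le_mono) auto
        ultimately show ?thesis using less.IH M' unfolding eq by blast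
      next
        assume "x \<in> Y"
        then obtain N' where N': "N' < N" "rank_le R {y \<in> Y. R x y} N'"
          using rank_leD[OF less.prems(2)] by blast
        then have "M + N' < S" using less.prems by simp
        moreover have "rank_le R {y \<in> X. R x y} M"
          using less.prems(1) by (rule rank_le_mono) auto
        ultimately show ?thesis using less.IH N' unfolding eq by blast
      qed
    qed
  qed
  then show ?thesis using assms by blast
qed

text \<open>Points of different parts never block each other, so plays in the two parts can be
  interleaved freely. For a target below \<open>M + N\<close>, \<open>less_add_mset_cases\<close>
  tells in which part to move.\<close>

lemma rank_ge_Un:
  fixes M N :: "'b::wellorder multiset"
  assumes "rank_ge R X M" "rank_ge R Y N" "\<And>x y. x \<in> X \<Longrightarrow> y \<in> Y \<Longrightarrow> R x y \<and> R y x"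
  shows "rank_ge R (X \<union> Y) (M + N)"
proof -
  have "rank_ge R (X \<union> Y) S"
    if "rank_ge R X M" "rank_ge R Y N" "S = M + N" "\<forall>x\<in>X. \<forall>y\<in>Y. R x y \<and> R y x" for S
    using that
  proof (induction S arbitrary: X Y M N rule: less_induct)
    case (less S)
    show ?case
    proof (rule rank_geI)
      fix K assume "K < S"
      then consider M' where "M' < M" "K \<le> M' + N" | N' where "N' < N" "K \<le> M + N'"
        using less_add_mset_cases less.prems(3) by blast
      then show "\<exists>x\<in>X \<union> Y. rank_ge R {y \<in> X \<union> Y. R x y} K"
      proof cases
        case 1
        then obtain x where x: "x \<in> X" "rank_ge R {y \<in> X. R x y} M'"
          using rank_geD[OF less.prems(1)] by blast
        have "rank_ge R ({y \<in> X. R x y} \<union> Y) (M' + N)"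
          by (rule less.IH[OF _ x(2) less.prems(2) refl]) (use 1 less.prems in auto)
        then have "rank_ge R {y \<in> X \<union> Y. R x y} K"
          by (rule rank_ge_mono) (use x less.prems(4) 1 in auto)
        then show ?thesis using x by blast
      next
        case 2
        then obtain x where x: "x \<in> Y" "rank_ge R {y \<in> Y. R x y} N'"
          using rank_geD[OF less.prems(2)] by blast
        have "rank_ge R (X \<union> {y \<in> Y. R x y}) (M + N')"
          by (rule less.IH[OF _ less.prems(1) x(2) refl]) (use 2 less.prems in auto)
        then have "rank_ge R {y \<in> X \<union> Y. R x y} K"
          by (rule rank_ge_mono) (use x less.prems(4) 2 in auto)
        then show ?thesis using x by blast
      qed
    qed
  qed
  then show ?thesis using assms by blast
qed

lemma rank_le_UN:
  fixes M :: "'s \<Rightarrow> 'b::wellorder multiset"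
  assumes "finite S" "\<And>s. s \<in> S \<Longrightarrow> rank_le R (X s) (M s)"
  shows "rank_le R (\<Union>s\<in>S. X s) (\<Sum>s\<in>S. M s)"
  using assms by (induction S rule: finite_induct) (auto intro: rank_le_Un rank_le_empty)

lemma rank_ge_UN:
  fixes M :: "'s \<Rightarrow> 'b::wellorder multiset"
  assumes "finite S" "\<And>s. s \<in> S \<Longrightarrow> rank_ge R (X s) (M s)"
    "\<And>s t x y. s \<in> S \<Longrightarrow> t \<in> S \<Longrightarrow> s \<noteq> t \<Longrightarrow> x \<in> X s \<Longrightarrow> y \<in> X t \<Longrightarrow> R x y"
  shows "rank_ge R (\<Union>s\<in>S. X s) (\<Sum>s\<in>S. M s)"
  using assms
proof (induction S rule: finite_induct)
  case empty
  then show ?case by (simp add: rank_ge_empty_iff)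
next
  case (insert s S)
  have "rank_ge R (X s \<union> (\<Union>s\<in>S. X s)) (M s + (\<Sum>s\<in>S. M s))"
  proof (rule rank_ge_Un)
    show "rank_ge R (\<Union>s\<in>S. X s) (\<Sum>s\<in>S. M s)" using insert.IH insert.prems by blast
    fix x y assume "x \<in> X s" "y \<in> (\<Union>s\<in>S. X s)"
    then obtain t where "t \<in> S" "y \<in> X t" by blast
    then show "R x y \<and> R y x" using insert.hyps insert.prems(2) \<open>x \<in> X s\<close> by (metis insertI1 insertI2)
  qed (use insert.prems in blast)
  then show ?case using insert by simp
qed

lemma rank_le_singleton: "\<not> R x x \<Longrightarrow> rank_le R {x} {#m::'b::wellorder#}"
  by (rule rank_leI) (auto intro!: exI[of _ "{#}"] intro: rank_leI)

lemma rank_ge_nonempty: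
  fixes m :: "'b::wellorder"
  assumes "X \<noteq> {}" "\<And>y. \<not> y < m"
  shows "rank_ge R X {#m#}"
proof (rule rank_geI)
  fix M' assume "M' < {#m#}"
  then have "M' = {#}" using assms(2) by (cases M') auto
  then show "\<exists>x\<in>X. rank_ge R {y \<in> X. R x y} M'" using assms(1)
    by (auto intro!: rank_geI)
qed

text \<open>\<open>p\<close> is the significant coordinate. After z, a remaining point either has
  its \<open>p\<close> in the residual of \<open>p z\<close>, and these points contribute \<omega>^G
  N', or it shares \<open>p z\<close>, and these contribute some K < \<omega>^G. Irreflexivity of
  \<open>RB\<close> leaves the fibre over \<open>p z\<close> to \<open>RA\<close> alone.\<close>

lemma rank_le_lex:
  fixes N :: "'b::wellorder multiset multiset"
  assumes A: "rank_le RA A {#G#}" and B: "rank_le RB B N"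
    and Z: "p ` Z \<subseteq> B" "q ` Z \<subseteq> A" and irr: "\<And>z. z \<in> Z \<Longrightarrow> \<not> RB (p z) (p z)"
    and R: "\<And>z z'. z \<in> Z \<Longrightarrow> z' \<in> Z \<Longrightarrow> R z z' \<Longrightarrow>
      RB (p z) (p z') \<or> p z = p z' \<and> RA (q z) (q z')"
  shows "rank_le R Z (image_mset ((+) G) N)"
  using B Z irr R
proof (induction N arbitrary: B Z rule: less_induct)
  case (less N)
  show ?case
  proof (rule rank_leI)
    fix z assume z: "z \<in> Z"
    obtain N' where N': "N' < N" "rank_le RB {y \<in> B. RB (p z) y} N'"
      using rank_leD[OF less.prems(1)] less.prems(2) z by blast
    obtain K where K: "K < {#G#}" "rank_le RA {y \<in> A. RA (q z) y} K"
      using rank_leD[OF A] less.prems(3) z by blast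
    define Z1 where "Z1 = {y \<in> Z. R z y \<and> RB (p z) (p y)}"
    define Z2 where "Z2 = {y \<in> Z. R z y \<and> p z = p y \<and> RA (q z) (q y)}"
    have "rank_le R Z1 (image_mset ((+) G) N')"
      by (rule less.IH[OF N']) (use less.prems in \<open>auto simp: Z1_def\<close>)
    moreover have "rank_le R Z2 K"
    proof (rule rank_le_map[OF K(2) order_refl, where f = q])
      show "q ` Z2 \<subseteq> {y \<in> A. RA (q z) y}" using less.prems by (auto simp: Z2_def)
      fix x y assume "x \<in> Z2" "y \<in> Z2" "R x y"
      then show "RA (q x) (q y)"
        using less.prems(5)[of x y] less.prems(4)[of y] by (auto simp: Z2_def)
    qed
    ultimately have "rank_le R (Z1 \<union> Z2) (image_mset ((+) G) N' + K)" by (rule rank_le_Un)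
    moreover have "Z1 \<union> Z2 = {y \<in> Z. R z y}" using less.prems(5) z by (auto simp: Z1_def Z2_def)
    ultimately show "\<exists>M'<image_mset ((+) G) N. rank_le R {y \<in> Z. R z y} M'"
      using image_add_less[OF N'(1) K(1)] by metis
  qed
qed

text \<open>Divide the target by \<omega>^G: the quotient N' chooses b, the remainder
  \<open>K\<close> chooses a. The residual of (a, b) contains the full rows over the residual of b
  and the rest of the row of b, and these do not block each other because \<open>RB\<close> is
  symmetric.\<close>

lemma rank_ge_lex:
  fixes N :: "'b::wellorder multiset multiset"
  assumes A: "rank_ge RA A {#G#}" and B: "rank_ge RB B N"
    and N: "N \<le> {#{#e#}#}" and G: "\<forall>x\<in>#G. e \<le> x"
    and Z: "\<And>a b. a \<in> A \<Longrightarrow> b \<in> B \<Longrightarrow> c a b \<in> Z"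
    and symm: "\<And>x y. RB x y \<Longrightarrow> RB y x"
    and R: "\<And>a b a' b'. a \<in> A \<Longrightarrow> b \<in> B \<Longrightarrow> a' \<in> A \<Longrightarrow> b' \<in> B \<Longrightarrow>
      RB b b' \<or> b = b' \<and> RA a a' \<Longrightarrow> R (c a b) (c a' b')"
  shows "rank_ge R Z (image_mset ((+) G) N)"
proof -
  let ?R = "\<lambda>(a, b) (a', b'). RB b b' \<or> b = b' \<and> RA a a'"
  have "rank_ge ?R (A \<times> B) (image_mset ((+) G) N)"
    using B N
  proof (induction N arbitrary: B rule: less_induct)
    case (less N)
    show ?case
    proof (rule rank_geI)
      fix M assume "M < image_mset ((+) G) N"
      then obtain N' K where NK: "N' < N" "K < {#G#}" "M = image_mset ((+) G) N' + K"
        using less_image_add_cases less.prems(2) G by blast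
      obtain b where b: "b \<in> B" "rank_ge RB {y \<in> B. RB b y} N'"
        using rank_geD[OF less.prems(1) NK(1)] by blast
      obtain a where a: "a \<in> A" "rank_ge RA {y \<in> A. RA a y} K"
        using rank_geD[OF assms(1) NK(2)] by blast
      have "rank_ge ?R (A \<times> {y \<in> B. RB b y}) (image_mset ((+) G) N')"
        using less.IH[OF NK(1) b(2)] NK(1) less.prems(2) by (meson less_imp_le less_le_trans)
      moreover have "rank_ge ?R ({y \<in> A. RA a y} \<times> {b}) K"
        by (rule rank_ge_map[OF a(2) order_refl, where f = "\<lambda>a. (a, b)"]) auto
      ultimately have "rank_ge ?R (A \<times> {y \<in> B. RB b y} \<union> {y \<in> A. RA a y} \<times> {b}) M"
        unfolding NK(3) by (rule rank_ge_Un) (auto dest: symm)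
      then have "rank_ge ?R {y \<in> A \<times> B. ?R (a, b) y} M"
        by (rule rank_ge_mono) (use b in auto)
      then show "\<exists>x\<in>A \<times> B. rank_ge ?R {y \<in> A \<times> B. ?R x y} M" using a b by blast
    qed
  qed
  then show ?thesis
    by (rule rank_ge_map[where f = "\<lambda>(a, b). c a b"]) (use Z R in auto)
qed

section \<open>Initial segments as order types\<close>

lemma Field_ordR: "Field (ordR a) = {x. x < a}"
  by (auto simp: ordR_def Field_def)

lemma Well_order_ordR: "Well_order (ordR a)"
proof -
  have "wf (ordR a - Id)"
    by (rule wf_subset[OF wf]) (auto simp: ordR_def)
  then show ?thesis
    by (auto simp: well_order_on_def linear_order_on_def partial_order_on_def preorder_on_def
        refl_on_def trans_def antisym_def total_on_def Field_ordR) (auto simp: ordR_def)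
qed

lemma ordIso_ordRI:
  assumes bij: "bij_betw f (Field r) {x. x < m}"
    and ord: "\<And>x y. x \<in> Field r \<Longrightarrow> y \<in> Field r \<Longrightarrow> (x, y) \<in> r \<longleftrightarrow> f x \<le> f y"
  shows "(ordR m, r) \<in> ordIso"
proof -
  let ?g = "inv_into (Field r) f"
  have bij': "bij_betw ?g {x. x < m} (Field r)" using bij by (rule bij_betw_inv_into)
  have g: "?g x \<in> Field r" "f (?g x) = x" if "x < m" for x
    using bij that by (auto simp: bij_betw_def f_inv_into_f inv_into_into)
  have "dir_image (ordR m) ?g = r"
  proof (rule set_eqI, clarify)
    fix x y
    show "(x, y) \<in> dir_image (ordR m) ?g \<longleftrightarrow> (x, y) \<in> r"
    proof
      assume "(x, y) \<in> dir_image (ordR m) ?g"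
      then obtain u v where uv: "u \<le> v" "v < m" "x = ?g u" "y = ?g v"
        by (auto simp: dir_image_def ordR_def)
      then have "u < m" by simp
      with uv show "(x, y) \<in> r" by (simp add: ord g)
    next
      assume xy: "(x, y) \<in> r"
      then have F: "x \<in> Field r" "y \<in> Field r" by (auto simp: Field_def)
      then have "f x \<le> f y" "f y < m" using ord xy bij by (auto simp: bij_betw_def)
      moreover have "x = ?g (f x)" "y = ?g (f y)" using F bij by (auto simp: bij_betw_def)
      ultimately show "(x, y) \<in> dir_image (ordR m) ?g" by (auto simp: dir_image_def ordR_def)
    qed
  qed
  then show ?thesis
    using dir_image_ordIso[OF Well_order_ordR[of m], of ?g] bij' by (simp add: Field_ordR bij_betw_def)
qed

lemma ordIso_ordRD:
  assumes "(ordR m, r) \<in> ordIso"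
  obtains f where "bij_betw f {x. x < m} (Field r)"
    "\<And>x y. x < m \<Longrightarrow> y < m \<Longrightarrow> (f x, f y) \<in> r \<longleftrightarrow> x \<le> y"
proof -
  obtain f where "iso (ordR m) r f" using assms by (auto simp: ordIso_def)
  then show thesis by (intro that[of f]) (auto simp: iso_iff2 Field_ordR, auto simp: ordR_def)
qed

text \<open>An order isomorphism f between initial segments satisfies x \<le> f x, so it cannot lead
  into a shorter one. For multisets this turns equality of order types into equality of normal
  forms.\<close>

lemma ordR_inj:
  fixes a b :: "'o::wellorder"
  assumes "(ordR a, ordR b) \<in> ordIso"
  shows "a = b"
proof -
  have no: False if ab: "a < b" and iso: "(ordR b, ordR a) \<in> ordIso" for a b :: 'o
  proof -
    obtain f where bij: "bij_betw f {x. x < b} {x. x < a}"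
      and ord: "\<And>x y. x < b \<Longrightarrow> y < b \<Longrightarrow> (f x, f y) \<in> ordR a \<longleftrightarrow> x \<le> y"
      using ordIso_ordRD[OF iso] by (auto simp: Field_ordR)
    have fa: "f x < a" if "x < b" for x using bij that by (auto simp: bij_betw_def)
    have mono: "f x < f y" if "x < y" "y < b" for x y
      using ord[of y x] fa[of x] fa[of y] that by (force simp: ordR_def not_le)
    have "x \<le> f x" if "x < b" for x
      using that
    proof (induction x rule: less_induct)
      case (less x)
      show ?case
      proof (rule ccontr)
        assume "\<not> x \<le> f x"
        then have "f x < x" by simp
        then have "f x \<le> f (f x)" "f (f x) < f x" using less mono by auto
        then show False by simp
      qed
    qed
    then show False using fa[OF ab] ab by fastforce
  qed
  have "(ordR b, ordR a) \<in> ordIso" using assms by (rule ordIso_symmetric)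
  then show ?thesis using no[of a b] no[of b a] assms by (cases a b rule: linorder_cases) auto
qed

lemma initial_ordIso:
  fixes h :: "'a::wellorder \<Rightarrow> 'o::wellorder"
  assumes "strict_mono h" "\<And>a x. x < h a \<Longrightarrow> \<exists>b. x = h b"
  shows "(ordR (h a), ordR a) \<in> ordIso"
proof (rule ordIso_ordRI[where f = h])
  show "bij_betw h (Field (ordR a)) {x. x < h a}"
    unfolding Field_ordR bij_betw_def
    using assms strict_mono_less[OF assms(1)] strict_mono_imp_inj_on[OF assms(1)]
    by (auto intro: inj_on_subset) (metis image_eqI mem_Collect_eq)
qed (auto simp: Field_ordR, auto simp: ordR_def strict_mono_less_eq[OF assms(1)])

section \<open>Ranks of trees of sequences\<close>

definition seqs :: "('x \<Rightarrow> 'x \<Rightarrow> bool) \<Rightarrow> 'x set \<Rightarrow> 'x list set" where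
  "seqs R X = {xs. set xs \<subseteq> X \<and> sorted_wrt R xs}"

abbreviation (input) bad :: "('x \<Rightarrow> 'x \<Rightarrow> bool) \<Rightarrow> 'x \<Rightarrow> 'x \<Rightarrow> bool" where
  "bad le x y \<equiv> \<not> le x y"

abbreviation (input) inc :: "('x \<Rightarrow> 'x \<Rightarrow> bool) \<Rightarrow> 'x \<Rightarrow> 'x \<Rightarrow> bool" where
  "inc le x y \<equiv> \<not> le x y \<and> \<not> le y x"

lemma bad_seqs_eq: "bad_seqs A = seqs (bad (snd A)) (fst A)"
  by (auto simp: bad_seqs_def seqs_def sorted_wrt_iff_nth_less)

lemma antichain_seqs_eq: "antichain_seqs A = seqs (inc (snd A)) (fst A)"
  unfolding antichain_seqs_def seqs_def sorted_wrt_iff_nth_less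
  by (rule Collect_cong) (metis less_trans linorder_neqE_nat order_less_irrefl)

text \<open>The witness sends s to the least bound \<open>rk s\<close> of its residual:
  \<open>rank_leD\<close> makes it decrease along children, \<open>rank_leI\<close> makes it the
  least such value. The lower bound enters to identify the value at the root as m. In the encoding
  of \<open>rank_is\<close>, k < m becomes \<open>Some (f k)\<close> and m itself, the type of r,
  becomes \<open>None\<close>.\<close>

lemma rank_is_seqs:
  fixes m :: "'o::wellorder"
  assumes le: "rank_le R X m" and ge: "rank_ge R X m" and iso: "(ordR m, r) \<in> ordIso"
  shows "rank_is (seqs R X) r"
proof -
  obtain f where bij: "bij_betw f {x. x < m} (Field r)"
    and ord: "\<And>x y. x < m \<Longrightarrow> y < m \<Longrightarrow> (f x, f y) \<in> r \<longleftrightarrow> x \<le> y"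
    using ordIso_ordRD[OF iso] by blast
  have inj: "f x = f y \<longleftrightarrow> x = y" if "x < m" "y < m" for x y
    using bij that by (auto simp: bij_betw_def inj_on_def)
  have fF: "f x \<in> Field r" if "x < m" for x using bij that by (auto simp: bij_betw_def)
  define res where "res s = {y \<in> X. \<forall>x\<in>set s. R x y}" for s
  define rk where "rk s = (LEAST k::'o. rank_le R (res s) k)" for s
  have "rank_le R (res s) m" for s
    using le by (rule rank_le_mono) (auto simp: res_def)
  then have rk: "rank_le R (res s) (rk s)" and rk_le: "rk s \<le> m" for s
    unfolding rk_def by (auto intro: LeastI Least_le)
  have res_snoc: "res (s @ [x]) = {y \<in> res s. R x y}" for s x by (auto simp: res_def)
  have child: "s @ [x] \<in> seqs R X \<longleftrightarrow> s \<in> seqs R X \<and> x \<in> res s" for s x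
    by (auto simp: seqs_def res_def sorted_wrt_append)
  have rk_snoc: "rk (s @ [x]) < rk s" if x: "x \<in> res s" for s x
  proof -
    obtain k where "k < rk s" "rank_le R (res (s @ [x])) k"
      using rank_leD[OF rk x] unfolding res_snoc by blast
    moreover from this have "rk (s @ [x]) \<le> k" unfolding rk_def by (auto intro: Least_le)
    ultimately show ?thesis by simp
  qed
  have rk_least: "rk s \<le> k" if "\<And>x. x \<in> res s \<Longrightarrow> rk (s @ [x]) < k" for s k
  proof -
    have "rank_le R (res s) k"
      using rk that unfolding res_snoc[symmetric] by (intro rank_leI) (metis res_snoc)
    then show ?thesis unfolding rk_def by (auto intro: Least_le)
  qed
  have "res [] = X" by (auto simp: res_def)
  then have rk_Nil: "rk [] = m" using rank_ge_le[OF ge] rk[of "[]"] rk_le[of "[]"] by force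
  define val where "val k = (if k = m then None else Some (f k))" for k
  have eless: "eless r (val j) (val k) \<longleftrightarrow> j < k" if "j \<le> m" "k \<le> m" for j k
    using that ord[of j k] inj[of j k] fF[of j] by (auto simp: val_def)
  have evalid: "evalid r u \<longleftrightarrow> (\<exists>k\<le>m. u = val k)" for u
  proof (cases u)
    case (Some x)
    have "x \<in> Field r \<longleftrightarrow> (\<exists>k<m. x = f k)" using bij by (auto simp: bij_betw_def)
    then show ?thesis using Some by (auto simp: val_def order_less_le)
  qed (auto simp: val_def)
  have "is_lsub r {val (rk t) |t. t \<in> seqs R X \<and> (\<exists>x. t = s @ [x])} (val (rk s))"
    if s: "s \<in> seqs R X" for s
    unfolding is_lsub_def
  proof (intro conjI allI impI ballI)
    show "evalid r (val (rk s))" using evalid rk_le by blast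
  next
    fix v assume "v \<in> {val (rk t) |t. t \<in> seqs R X \<and> (\<exists>x. t = s @ [x])}"
    then show "eless r v (val (rk s))" using eless rk_le rk_snoc child by auto
  next
    fix u assume u: "evalid r u \<and>
      (\<forall>v\<in>{val (rk t) |t. t \<in> seqs R X \<and> (\<exists>x. t = s @ [x])}. eless r v u)"
    then obtain k where k: "k \<le> m" "u = val k" using evalid by blast
    have "rk (s @ [x]) < k" if "x \<in> res s" for x
    proof -
      have "eless r (val (rk (s @ [x]))) u" using u child s that by blast
      then show ?thesis using eless rk_le k by blast
    qed
    then have "rk s \<le> k" by (rule rk_least)
    then show "\<not> eless r u (val (rk s))" using eless k rk_le by auto
  qed
  moreover have "wf {(t, s). s \<in> seqs R X \<and> t \<in> seqs R X \<and> (\<exists>x. t = s @ [x])}"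
    by (rule wf_subset[OF wf_inv_image[OF wf, of rk]])
      (use child rk_snoc in \<open>auto simp: inv_image_def\<close>)
  moreover have "Well_order r" using iso by (auto simp: ordIso_def)
  moreover have "val (rk []) = None" by (simp add: val_def rk_Nil)
  ultimately show ?thesis unfolding rank_is_def by (intro conjI exI[of _ "\<lambda>s. val (rk s)"]) auto
qed

text \<open>This serves the widths for finite \<alpha>, which are compared rather than computed: the
  rank function itself is carried along the isomorphism, s receiving the value of
  \<open>map g s\<close>.\<close>

lemma rank_is_seqs_transfer:
  assumes bij: "bij_betw h X Y"
    and R: "\<And>x y. x \<in> X \<Longrightarrow> y \<in> X \<Longrightarrow> R' (h x) (h y) \<longleftrightarrow> R x y"
    and rank: "rank_is (seqs R X) r"
  shows "rank_is (seqs R' Y) r"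
proof -
  define g where "g = inv_into X h"
  have g: "g y \<in> X" "h (g y) = y" if "y \<in> Y" for y
    using bij that by (auto simp: g_def bij_betw_def inv_into_into f_inv_into_f)
  have gh: "g (h x) = x" "h x \<in> Y" if "x \<in> X" for x
    using bij that by (auto simp: g_def bij_betw_def)
  have Rg: "R (g x) (g y) \<longleftrightarrow> R' x y" if "x \<in> Y" "y \<in> Y" for x y
    using R[of "g x" "g y"] g that by simp
  have gseq: "map g s \<in> seqs R X" if "s \<in> seqs R' Y" for s
    using that g sorted_wrt_mono_rel[of s R' "\<lambda>x y. R (g x) (g y)"] Rg
    by (auto simp: seqs_def sorted_wrt_map subset_iff)
  have hseq: "map h s \<in> seqs R' Y" if "s \<in> seqs R X" for s
    using that gh sorted_wrt_mono_rel[of s R "\<lambda>x y. R' (h x) (h y)"] R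
    by (auto simp: seqs_def sorted_wrt_map subset_iff)
  have hg: "map h (map g s) = s" if "s \<in> seqs R' Y" for s
    using that g by (auto simp: seqs_def intro!: map_idI)
  have ghs: "map g (map h s) = s" if "s \<in> seqs R X" for s
    using that gh by (auto simp: seqs_def intro!: map_idI)
  from rank obtain \<rho> where wo: "Well_order r"
    and wf: "wf {(t, s). s \<in> seqs R X \<and> t \<in> seqs R X \<and> (\<exists>x. t = s @ [x])}"
    and \<rho>: "\<rho> [] = None"
      "\<And>s. s \<in> seqs R X \<Longrightarrow> is_lsub r {\<rho> t |t. t \<in> seqs R X \<and> (\<exists>x. t = s @ [x])} (\<rho> s)"
    unfolding rank_is_def by blast
  have "wf {(t, s). s \<in> seqs R' Y \<and> t \<in> seqs R' Y \<and> (\<exists>x. t = s @ [x])}"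
    by (rule wf_subset[OF wf_inv_image[OF wf, of "map g"]]) (use gseq in \<open>auto simp: inv_image_def; force\<close>)
  moreover have "is_lsub r {\<rho> (map g t) |t. t \<in> seqs R' Y \<and> (\<exists>x. t = s @ [x])} (\<rho> (map g s))"
    if s: "s \<in> seqs R' Y" for s
  proof -
    have "{\<rho> (map g t) |t. t \<in> seqs R' Y \<and> (\<exists>x. t = s @ [x])} =
        {\<rho> t |t. t \<in> seqs R X \<and> (\<exists>x. t = map g s @ [x])}" (is "?L = ?R")
    proof
      show "?L \<subseteq> ?R" using gseq by force
      show "?R \<subseteq> ?L"
      proof clarify
        fix x assume t: "map g s @ [x] \<in> seqs R X"
        then show "\<exists>t. \<rho> (map g s @ [x]) = \<rho> (map g t) \<and> t \<in> seqs R' Y \<and> (\<exists>x. t = s @ [x])"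
          using hseq[OF t] ghs[OF t] hg[OF s] by (intro exI[of _ "s @ [h x]"]) auto
      qed
    qed
    then show ?thesis using \<rho>(2)[OF gseq[OF s]] by simp
  qed
  ultimately show ?thesis unfolding rank_is_def using wo \<rho>(1)
    by (intro conjI exI[of _ "\<lambda>s. \<rho> (map g s)"]) auto
qed

section \<open>Cantor normal forms\<close>

text \<open>The initial-segment embedding of \<open>'a\<close> into its multisets: \<open>expo a\<close> lists the exponents of
  the Cantor normal form of \<open>a\<close>, as elements of \<open>'a\<close>.\<close>

function expo :: "'a::wellorder \<Rightarrow> 'a multiset" where
  "expo a = (LEAST M. \<forall>b\<in>{b. b < a}. expo b < M)"
  by auto
termination by (relation "{(x, y). x < y}") (auto simp: wf)

declare expo.simps [simp del]

text \<open>The inequality a \<le> \<omega>^a. It also shows that the set minimized in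
  \<open>expo\<close> is nonempty.\<close>

lemma expo_le_single: "expo a \<le> {#a#}"
proof (induction a rule: less_induct)
  case (less a)
  have "expo b < {#a#}" if "b < a" for b
    using less[OF that] that by (meson le_less_trans mset_lt_single_iff)
  then show ?case unfolding expo.simps[of a] by (intro Least_le) blast
qed

lemma expo_less: "b < a \<Longrightarrow> expo b < expo a"
proof -
  assume "b < a"
  have "\<forall>b\<in>{b. b < a}. expo b < {#a#}"
    by (metis expo_le_single le_less_trans mem_Collect_eq mset_lt_single_iff)
  from LeastI[of "\<lambda>M. \<forall>b\<in>{b. b < a}. expo b < M", OF this] \<open>b < a\<close>
  show ?thesis by (subst (2) expo.simps) auto
qed

lemma strict_mono_expo: "strict_mono expo"
  by (simp add: strict_mono_def expo_less)

lemma expo_less_iff [simp]: "expo a < expo b \<longleftrightarrow> a < b"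
  by (rule strict_mono_less[OF strict_mono_expo])

lemma expo_eq_iff [simp]: "expo a = expo b \<longleftrightarrow> a = b"
  by (rule strict_mono_eq[OF strict_mono_expo])

text \<open>Minimality in \<open>expo\<close> leaves no gaps: a multiset below \<open>expo a\<close>
  is at most some \<open>expo b\<close> with b < a, and induction applies.\<close>

lemma expo_initial: "M < expo a \<Longrightarrow> \<exists>b<a. M = expo b"
proof (induction a rule: less_induct)
  case (less a)
  have "\<not> (\<forall>b\<in>{b. b < a}. expo b < M)"
    using less.prems by (subst (asm) expo.simps) (auto dest: not_less_Least)
  then obtain b where b: "b < a" "M \<le> expo b" by force
  then show ?case using less.IH[OF b(1)] by (metis order.strict_iff_order less_trans)
qed

text \<open>The ordinal \<open>a\<close> with its exponents themselves in Cantor normal form; unlike in \<open>expo a\<close>,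
  exponents can be added here.\<close>

definition val :: "'a::wellorder \<Rightarrow> 'a multiset multiset" where
  "val a = image_mset expo (expo a)"

lemma val_less_iff [simp]: "val a < val b \<longleftrightarrow> a < b"
proof -
  have "val a < val b" if "a < b" for a b :: 'a
    unfolding val_def using that by (intro image_mset_less) auto
  then have "strict_mono (val :: 'a \<Rightarrow> _)" by (simp add: strict_mono_def)
  then show ?thesis by (rule strict_mono_less)
qed

lemma strict_mono_val: "strict_mono val"
  by (simp add: strict_mono_def)

text \<open>Two levels have to be inverted. An exponent x of \<open>M\<close> outside the range of
  \<open>expo\<close> would exceed every exponent of \<open>val a\<close>, since that range is an
  initial segment; then \<open>M\<close> would exceed \<open>val a\<close>. So \<open>M\<close> is
  an image, and \<open>expo_initial\<close> applies to its preimage.\<close>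

lemma val_initial: assumes "M < val a" shows "\<exists>b<a. M = val b"
proof -
  have "\<exists>y. x = expo y" if x: "x \<in># M" for x
  proof (rule ccontr)
    assume no: "\<nexists>y. x = expo y"
    have "y < x" if "y \<in># val a" for y
      using that no expo_initial unfolding val_def by (metis image_mset_eq_plusD imageE set_image_mset linorder_neqE)
    then have "val a < M" using x ex_gt_imp_less_multiset by blast
    then show False using assms by simp
  qed
  then have "\<exists>g. \<forall>x\<in>#M. x = expo (g x)" by metis
  then obtain g where "\<forall>x\<in>#M. x = expo (g x)" by blast
  then have "image_mset expo (image_mset g M) = image_mset id M"
    unfolding multiset.map_comp by (intro image_mset_cong) auto
  then have M: "M = image_mset expo (image_mset g M)" by simp
  have "image_mset g M < expo a"
  proof (rule ccontr)
    assume "\<not> image_mset g M < expo a"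
    then have "expo a \<le> image_mset g M" by simp
    then have "val a \<le> M"
      unfolding val_def by (subst M) (metis (no_types, lifting) expo_less_iff image_mset_less le_less)
    then show False using assms by simp
  qed
  then obtain b where b: "b < a" "image_mset g M = expo b" using expo_initial by blast
  then have "M = val b" using M by (simp add: val_def)
  then show ?thesis using b by blast
qed

lemma ordIso_expo: "(ordR (expo a), ordR a) \<in> ordIso"
  by (rule initial_ordIso[OF strict_mono_expo]) (use expo_initial in blast)

lemma ordIso_val: "(ordR (val a), ordR a) \<in> ordIso"
  by (rule initial_ordIso[OF strict_mono_val]) (use val_initial in blast)

section \<open>Order types of powers of \<omega> and of their ordinal sums\<close>

lemma Field_omegapow: "Field (omegapow e) = {h. fsupp e h}"
  by (auto simp: omegapow_def Field_def)

definition msupp :: "('a \<Rightarrow> nat) \<Rightarrow> 'a multiset" where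
  "msupp h = Abs_multiset h"

lemma count_msupp: "fsupp e h \<Longrightarrow> count (msupp h) = h"
  by (simp add: msupp_def fsupp_def count_Abs_multiset)

lemma msupp_less_single: "fsupp e h \<Longrightarrow> msupp h < {#e#}"
  by (auto simp: fsupp_def count_msupp[symmetric] count_msupp simp flip: count_greater_zero_iff)

lemma fsupp_count: "K < {#e#} \<Longrightarrow> fsupp e (count K)"
  by (auto simp: fsupp_def)

lemma msupp_count [simp]: "msupp (count K) = K"
  by (simp add: msupp_def)

text \<open>Over a total order the multiset order is decided at the largest element where the counts
  differ, which is how \<open>omegapow\<close> compares functions.\<close>

lemma omegapow_iff:
  assumes "fsupp e f" "fsupp e g"
  shows "(f, g) \<in> omegapow e \<longleftrightarrow> msupp f \<le> msupp g"
proof -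
  have less: "msupp f < msupp g" if fs: "fsupp e f" "fsupp e g" and "f (Max {z. f z \<noteq> g z}) < g (Max {z. f z \<noteq> g z})" for f g
  proof -
    let ?D = "{z. f z \<noteq> g z}"
    have fin: "finite ?D"
      by (rule finite_subset[of _ "{z. f z \<noteq> 0} \<union> {z. g z \<noteq> 0}"]) (use fs in \<open>auto simp: fsupp_def\<close>)
    have "msupp f \<noteq> msupp g" using that count_msupp by (metis less_irrefl)
    moreover have "\<exists>x>y. f x < g x" if y: "g y < f y" for y
    proof -
      have "y \<le> Max ?D" using fin y by (intro Max_ge) auto
      moreover have "y \<noteq> Max ?D" using y that by (metis less_asym \<open>f (Max ?D) < g (Max ?D)\<close>)
      ultimately have "y < Max ?D" by simp
      then show ?thesis using \<open>f (Max ?D) < g (Max ?D)\<close> by blast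
    qed
    ultimately show ?thesis unfolding less_multiset\<^sub>H\<^sub>O by (simp add: count_msupp[OF fs(1)] count_msupp[OF fs(2)])
  qed
  show ?thesis
  proof (cases "f = g")
    case True
    then show ?thesis using assms by (simp add: omegapow_def)
  next
    case False
    let ?D = "{z. f z \<noteq> g z}"
    have fin: "finite ?D"
      by (rule finite_subset[of _ "{z. f z \<noteq> 0} \<union> {z. g z \<noteq> 0}"]) (use assms in \<open>auto simp: fsupp_def\<close>)
    have "?D \<noteq> {}" using False by auto
    then have "Max ?D \<in> ?D" using fin by (rule Max_in[rotated])
    then have "f (Max ?D) < g (Max ?D) \<or> g (Max ?D) < f (Max ?D)" by auto
    moreover have "{z. g z \<noteq> f z} = ?D" by auto
    ultimately show ?thesis
      using less[OF assms] less[OF assms(2,1)] False assms by (auto simp: omegapow_def)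
  qed
qed

lemma less_mset_cnf:
  assumes "sorted_wrt (\<ge>) es" "K < mset (es :: 'a::wellorder list)"
  shows "\<exists>i<length es. \<exists>K'<{#es ! i#}. K = mset (take i es) + K'"
  using assms
proof (induction es rule: rev_induct)
  case (snoc e es)
  have "K < mset es \<or> (\<exists>K'<{#e#}. K = mset es + K')"
    by (rule less_add_le_single_cases[where e = e]) (use snoc.prems in \<open>auto simp: sorted_wrt_append\<close>)
  then show ?case
  proof
    assume "K < mset es"
    then obtain i K' where "i < length es" "K' < {#es ! i#}" "K = mset (take i es) + K'"
      using snoc.IH snoc.prems by (auto simp: sorted_wrt_append)
    then show ?thesis by (intro exI[of _ i]) (auto simp: nth_append)
  next
    assume "\<exists>K'<{#e#}. K = mset es + K'"
    then show ?thesis by (intro exI[of _ "length es"]) auto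
  qed
qed simp

lemma mset_take_mono: "i \<le> j \<Longrightarrow> mset (take i es) \<le> mset (take j (es :: 'a::wellorder list))"
proof -
  assume "i \<le> j"
  then have "take j es = take i es @ take (j - i) (drop i es)" by (metis le_add_diff_inverse take_add)
  then show ?thesis by (simp add: subset_eq_imp_le_multiset)
qed

text \<open>Block i of the ordinal sum starts at the sum of the first i terms, so (i, h) is sent to
  that sum plus h. Since the exponents decrease, the blocks leave no gaps, by
  \<open>less_mset_cnf\<close>.\<close>

lemma ordIso_osum_list:
  assumes es: "sorted_wrt (\<ge>) (es :: 'a::wellorder list)"
  shows "(ordR (mset es), osum_list (map omegapow es)) \<in> ordIso"
proof (rule ordIso_ordRI)
  let ?r = "osum_list (map omegapow es)"
  let ?f = "\<lambda>(i, h). mset (take i es) + msupp h"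
  have mem: "((i, x), (j, y)) \<in> ?r \<longleftrightarrow> i < length es \<and> j < length es \<and> fsupp (es ! i) x \<and> fsupp (es ! j) y \<and>
      (i < j \<or> i = j \<and> msupp x \<le> msupp y)" for i j x y
    by (auto simp: osum_list_def Field_omegapow omegapow_iff)
  have F: "Field ?r = {(i, h). i < length es \<and> fsupp (es ! i) h}"
  proof (rule set_eqI, clarify)
    fix i h
    have "(i, h) \<in> Field ?r \<longleftrightarrow> (\<exists>j x. ((i, h), (j, x)) \<in> ?r \<or> ((j, x), (i, h)) \<in> ?r)"
      by (auto simp: Field_def)
    then show "(i, h) \<in> Field ?r \<longleftrightarrow> (i, h) \<in> {(i, h). i < length es \<and> fsupp (es ! i) h}"
      unfolding mem by auto
  qed
  have up: "?f (i, h) < mset (take (Suc i) es)" if "i < length es" "fsupp (es ! i) h" for i h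
    using that msupp_less_single[OF that(2)] by (simp add: take_Suc_conv_app_nth)
  have less: "?f (i, h) < ?f (j, h')" if "i < j" "j < length es" "fsupp (es ! i) h" for i j h h'
  proof -
    have "?f (i, h) < mset (take (Suc i) es)" by (rule up) (use that in auto)
    also have "\<dots> \<le> mset (take j es)" by (rule mset_take_mono) (use that in auto)
    also have "\<dots> \<le> ?f (j, h')" by (simp add: subset_eq_imp_le_multiset)
    finally show ?thesis .
  qed
  show ord: "(x, y) \<in> ?r \<longleftrightarrow> ?f x \<le> ?f y" if "x \<in> Field ?r" "y \<in> Field ?r" for x y
  proof -
    obtain i h j h' where xy: "x = (i, h)" "y = (j, h')" by fastforce
    then have F': "i < length es" "fsupp (es ! i) h" "j < length es" "fsupp (es ! j) h'"
      using that F by auto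
    show ?thesis
      using less[of i j h h'] less[of j i h' h] F' unfolding xy mem
      by (cases i j rule: linorder_cases) (auto simp: not_le)
  qed
  have inj: "inj_on ?f (Field ?r)"
  proof (rule inj_onI)
    fix x y assume xy: "x \<in> Field ?r" "y \<in> Field ?r" "?f x = ?f y"
    then have "(x, y) \<in> ?r" "(y, x) \<in> ?r" using ord by auto
    moreover have "snd x = snd y" if "fst x = fst y"
      using xy that count_msupp unfolding F
      by (metis (mono_tags, lifting) add_left_cancel case_prodE case_prod_unfold fst_conv mem_Collect_eq snd_conv)
    ultimately show "x = y" by (cases x; cases y) (auto simp: mem)
  qed
  have "?f ` Field ?r = {K. K < mset es}"
  proof
    show "?f ` Field ?r \<subseteq> {K. K < mset es}"
    proof
      fix K assume "K \<in> ?f ` Field ?r"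
      then obtain i h where K: "K = ?f (i, h)" and ih: "i < length es" "fsupp (es ! i) h"
        by (auto simp: F)
      have "mset (take (Suc i) es) \<le> mset es"
        using mset_take_mono[of "Suc i" "length es" es] ih by simp
      then have "?f (i, h) < mset es" by (rule less_le_trans[OF up[OF ih]])
      then show "K \<in> {K. K < mset es}" unfolding K by blast
    qed
    show "{K. K < mset es} \<subseteq> ?f ` Field ?r"
    proof clarify
      fix K assume "K < mset es"
      then obtain i K' where iK: "i < length es" "K' < {#es ! i#}" "K = mset (take i es) + K'"
        using less_mset_cnf[OF es] by blast
      then have "(i, count K') \<in> Field ?r" by (simp add: F fsupp_count)
      then show "K \<in> ?f ` Field ?r" using iK(3) by (intro image_eqI[of _ _ "(i, count K')"]) auto
    qed
  qed
  then show "bij_betw ?f (Field ?r) {K. K < mset es}" using inj by (simp add: bij_betw_def)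
qed

text \<open>Existence and uniqueness of Cantor normal forms: the choice operator in
  \<open>cnf\<close> has exactly one candidate, the decreasing listing of
  \<open>expo a\<close>.\<close>

lemma is_cnf_iff: "is_cnf a es \<longleftrightarrow> sorted_wrt (\<ge>) es \<and> mset es = expo a"
proof -
  have "is_cnf a es \<longleftrightarrow> sorted_wrt (\<ge>) es \<and> (ordR a, osum_list (map omegapow es)) \<in> ordIso"
    by (auto simp: is_cnf_def sorted_wrt_iff_nth_less)
  also have "\<dots> \<longleftrightarrow> sorted_wrt (\<ge>) es \<and> (ordR (expo a), ordR (mset es)) \<in> ordIso"
    using ordIso_osum_list[of es] ordIso_expo[of a]
    by (meson ordIso_symmetric ordIso_transitive)
  also have "\<dots> \<longleftrightarrow> sorted_wrt (\<ge>) es \<and> mset es = expo a"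
    using ordR_inj[of "expo a" "mset es"] ordIso_reflexive[OF Well_order_ordR] by metis
  finally show ?thesis .
qed

lemma is_cnf_cnf: "is_cnf a (cnf a)"
proof -
  have "is_cnf a (rev (sorted_list_of_multiset (expo a)))"
    by (simp add: is_cnf_iff sorted_wrt_rev)
  then show ?thesis unfolding cnf_def by (rule someI)
qed

lemma mset_cnf: "mset (cnf a) = expo a" and sorted_cnf: "sorted_wrt (\<ge>) (cnf a)"
  using is_cnf_cnf[of a] by (auto simp: is_cnf_iff)

lemma ordIso_omegapow: "(ordR {#e#}, omegapow e) \<in> ordIso"
proof (rule ordIso_ordRI[where f = msupp])
  have "inj_on msupp {h. fsupp e h}" by (rule inj_onI) (metis count_msupp mem_Collect_eq)
  moreover have "msupp ` {h. fsupp e h} = {K. K < {#e#}}"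
    using msupp_less_single fsupp_count by (auto intro!: image_eqI[of _ _ "count _"])
  ultimately show "bij_betw msupp (Field (omegapow e)) {K. K < {#e#}}"
    by (simp add: bij_betw_def Field_omegapow)
qed (auto simp: Field_omegapow omegapow_iff)

text \<open>In a normal form with at least two terms each \<omega>^e lies below the whole, hence is
  the type of some element. So the definite description in \<open>elem_of\<close> denotes, and
  denotes a smaller index of the recursion.\<close>

lemma elem_of_omegapow:
  assumes "{#e#} < expo g"
  shows "elem_of (omegapow e) g < g" "expo (elem_of (omegapow e) g) = {#e#}"
proof -
  have iff: "(ordR y, omegapow e) \<in> ordIso \<longleftrightarrow> expo y = {#e#}" for y
  proof -
    have "(ordR y, omegapow e) \<in> ordIso \<longleftrightarrow> (ordR (expo y), ordR {#e#}) \<in> ordIso"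
      using ordIso_omegapow[of e] ordIso_expo[of y] by (meson ordIso_symmetric ordIso_transitive)
    then show ?thesis
      using ordR_inj[of "expo y" "{#e#}"] ordIso_reflexive[OF Well_order_ordR] by metis
  qed
  obtain y where "y < g" "expo y = {#e#}" using expo_initial[OF assms] by metis
  then have "\<exists>!y. y < g \<and> (ordR y, omegapow e) \<in> ordIso" unfolding iff by (metis expo_eq_iff)
  then show "elem_of (omegapow e) g < g" "expo (elem_of (omegapow e) g) = {#e#}"
    unfolding elem_of_def using theI'[of "\<lambda>y. y < g \<and> (ordR y, omegapow e) \<in> ordIso"] iff by auto
qed

section \<open>Base two exponentiation\<close>

text \<open>e is the least exponent, so adding it adds \<omega>^0 = 1.\<close>

lemma less_succ_iff:
  fixes N :: "'b::wellorder multiset"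
  assumes "\<And>y. e \<le> y"
  shows "N < add_mset e M \<longleftrightarrow> N \<le> M"
proof
  assume "N < add_mset e M"
  then have "N < M + {#e#}" by simp
  from less_add_le_single_cases[OF this order_refl] assms
  have "N < M \<or> (\<exists>K<{#e#}. N = M + K)" by blast
  moreover have "K = {#}" if "K < {#e#}" for K using that assms by (cases K) (auto simp: not_less[symmetric])
  ultimately show "N \<le> M" by (metis add.right_neutral less_imp_le order_refl)
next
  assume "N \<le> M"
  then show "N < add_mset e M" using le_multiset_right_total by (rule le_less_trans)
qed

lemma limit_cases [case_names zero succ limit]:
  fixes M :: "'b multiset multiset"
  obtains "M = {#}" | M' where "M = add_mset {#} M'" | "M \<noteq> {#}" "{#} \<notin># M"
  by (metis mset_add)

definition low :: "'a::wellorder" where "low = (LEAST x. True)"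

lemma low_le [simp]: "low \<le> x"
  unfolding low_def by (rule Least_le) simp

lemma not_less_low [simp]: "\<not> x < low"
  by (simp add: not_less)

text \<open>\<open>1 + epred f = f\<close> for \<open>f \<noteq> 0\<close> (ordinary sum), so that \<open>2^(\<omega>^f) = \<omega>^(\<omega>^(epred f))\<close>.\<close>

definition epred :: "'a::wellorder multiset \<Rightarrow> 'a multiset" where
  "epred f = (if \<exists>x\<in>#f. x \<noteq> low then f else f - {#low#})"

text \<open>Cancelling 1 on the left does not disturb what is appended on the right. If all terms of
  \<open>f\<close> are 1, then e is least and v \<le> 1, so the formula persists.\<close>

lemma epred_add:
  assumes "f \<noteq> {#}" "\<forall>y\<in>#f. e \<le> y" "v \<le> {#e#}"
  shows "epred (f + v) = epred f + v"
proof (cases "\<exists>x\<in>#f. x \<noteq> low")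
  case True
  then show ?thesis by (auto simp: epred_def)
next
  case False
  then have "low \<in># f" using assms(1) by (metis multiset_nonemptyE)
  then have "e = low" using assms(2) by (simp add: order.antisym)
  then have "x = low" if "x \<in># v" for x using assms(3) that by (auto simp: le_less)
  then show ?thesis using False \<open>low \<in># f\<close> by (auto simp: epred_def)
qed

lemma epred_le: "epred f \<le> f"
  by (auto simp: epred_def subset_eq_imp_le_multiset)

lemma le_epred_add: "f \<le> add_mset low (epred f)"
  by (rule subset_eq_imp_le_multiset) (auto simp: epred_def subseteq_mset_def)

text \<open>\<open>epred\<close> collapses just 0 and 1, both to 0; excluding 0 from the smaller
  argument restores strictness.\<close>

lemma epred_less:
  assumes "f < g" "f \<noteq> {#}"
  shows "epred f < epred g"
proof (cases "\<exists>x\<in>#g. x \<noteq> low")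
  case True
  then show ?thesis using epred_le[of f] assms(1) by (auto simp: epred_def[of g])
next
  case False
  have f: "x = low" if "x \<in># f" for x
  proof (rule ccontr)
    assume "x \<noteq> low"
    then have "low < x" by (simp add: order.not_eq_order_implies_strict)
    then have "g < f" using that False by (intro ex_gt_imp_less_multiset) auto
    then show False using assms(1) by simp
  qed
  have "g \<noteq> {#}" using assms by auto
  then have "low \<in># f" "low \<in># g" using f False assms(2) by (metis multiset_nonemptyE)+
  then obtain f' g' where "f = add_mset low f'" "g = add_mset low g'" by (metis mset_add)
  then show ?thesis using assms(1) f False by (auto simp: epred_def)
qed

lemma epred_surj: "\<exists>f. f \<noteq> {#} \<and> epred f = k"
proof (cases "\<exists>x\<in>#k. x \<noteq> low")
  case True
  then show ?thesis by (intro exI[of _ k]) (auto simp: epred_def)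
next
  case False
  then show ?thesis by (intro exI[of _ "add_mset low k"]) (auto simp: epred_def)
qed

text \<open>If \<alpha> = \<omega>^f_1 + ... + \<omega>^f_r + n with all f_i > 0, then 2^\<alpha> =
  \<omega>^(lpart \<alpha>) 2^n, because \<omega>^f_i contributes the factor
  \<omega>^(\<omega>^(epred f_i)). \<open>pow2\<close> records this formula, n being the
  multiplicity of the exponent 0.\<close>

definition lpart :: "'a::wellorder multiset multiset \<Rightarrow> 'a multiset multiset" where
  "lpart M = image_mset epred (filter_mset (\<lambda>f. f \<noteq> {#}) M)"

definition pow2 :: "'a::wellorder multiset multiset \<Rightarrow> 'a multiset multiset multiset" where
  "pow2 M = replicate_mset (2 ^ count M {#}) (lpart M)"

lemma pow2_zero [simp]: "pow2 {#} = {#{#}#}"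
  by (simp add: pow2_def lpart_def)

lemma replicate_mset_add: "replicate_mset (m + n) x = replicate_mset m x + replicate_mset n x"
  by (induction m) auto

lemma pow2_succ [simp]: "pow2 (add_mset {#} M) = pow2 M + pow2 M"
  by (simp add: pow2_def lpart_def mult_2 replicate_mset_add)

lemma lpart_limit: "{#} \<notin># M \<Longrightarrow> lpart M = image_mset epred M"
  unfolding lpart_def by (rule arg_cong[where f = "image_mset epred"]) (auto intro!: multiset_eqI simp: not_in_iff)

lemma pow2_limit: "{#} \<notin># M \<Longrightarrow> pow2 M = {#lpart M#}"
  by (simp add: pow2_def not_in_iff)

lemma pow2_nonzero [simp]: "pow2 M \<noteq> {#}"
  by (simp add: pow2_def)

lemma lpart_less:
  assumes "{#} \<notin># M" "K < M"
  shows "lpart K < lpart M"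
proof -
  let ?K = "filter_mset (\<lambda>f. f \<noteq> {#}) K"
  have "?K \<le> K" by (simp add: subset_eq_imp_le_multiset)
  then have "?K < M" using assms(2) by simp
  then have "image_mset epred ?K < image_mset epred M"
    by (rule image_mset_less) (use assms(1) in \<open>auto intro: epred_less\<close>)
  then show ?thesis using lpart_limit[OF assms(1)] by (simp add: lpart_def)
qed

lemma in_pow2_less: "{#} \<notin># M \<Longrightarrow> K < M \<Longrightarrow> x \<in># pow2 K \<Longrightarrow> x < lpart M"
  using lpart_less by (auto simp: pow2_def)

text \<open>At a limit, \<open>pow2 M\<close> is a single power of \<omega> and therefore closed
  under finite natural sums.\<close>

lemma sum_pow2_less_limit:
  assumes "{#} \<notin># M" "\<And>s. s \<in> S \<Longrightarrow> K s < M"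
  shows "(\<Sum>s\<in>S. pow2 (K s)) < pow2 M"
proof -
  have "x < lpart M" if x: "x \<in># (\<Sum>s\<in>S. pow2 (K s))" for x
  proof -
    have "finite S" using x by (metis empty_not_add_mset mset_add sum.infinite)
    then obtain s where "s \<in> S" "x \<in># pow2 (K s)" using x by (auto simp: set_mset_sum)
    then show ?thesis using in_pow2_less assms by blast
  qed
  then show ?thesis by (simp add: pow2_limit[OF assms(1)])
qed

lemma less_succ_limit:
  fixes M :: "'b::wellorder multiset multiset"
  assumes "{#} \<notin># M" "K < M"
  shows "add_mset {#} K < M"
proof -
  have "\<not> M \<le> add_mset {#} K"
  proof
    assume "M \<le> add_mset {#} K"
    then have "M = add_mset {#} K"
      using less_succ_iff[OF less_eq_multiset_empty_left, of M K] assms(2) by (auto simp: le_less)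
    then show False using assms(1) by simp
  qed
  then show ?thesis by simp
qed

lemma less_replicate_mset:
  fixes k :: "'b::wellorder"
  assumes "\<And>x. x \<in># K \<Longrightarrow> x \<le> k" "count K k < n"
  shows "K < replicate_mset n k"
proof -
  have "y < k" if "count (replicate_mset n k) y < count K y" for y
  proof -
    have "y \<in># K" using that by (rule count_less_imp_in)
    moreover have "y \<noteq> k" using that assms(2) by auto
    ultimately show ?thesis using assms(1) by (simp add: order.not_eq_order_implies_strict)
  qed
  then show ?thesis unfolding less_multiset\<^sub>H\<^sub>O using assms(2)
    by (metis count_replicate_mset less_irrefl)
qed

text \<open>Continuity at limits. The leading exponent k of \<open>K\<close> is
  \<open>lpart k'\<close> for some k' < M; every k' + n stays below the limit, and 2^(k' + n) =
  \<omega>^k 2^n.\<close>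

lemma pow2_sup:
  assumes "{#} \<notin># M" "M \<noteq> {#}" "K < pow2 M"
  shows "\<exists>N<M. K < pow2 N"
proof (cases "K = {#}")
  case True
  then show ?thesis using assms(2) by (intro exI[of _ "{#}"]) auto
next
  case False
  have K: "x < lpart M" if "x \<in># K" for x using assms(1,3) that by (simp add: pow2_limit)
  define k where "k = Max (set_mset K)"
  have k: "k \<in># K" "\<And>x. x \<in># K \<Longrightarrow> x \<le> k" using False by (auto simp: k_def)
  \<comment> \<open>Preimages are taken nonzero so that \<open>lpart\<close> discards none of
    them.\<close>
  have "\<exists>g. \<forall>x\<in>#k. g x \<noteq> {#} \<and> epred (g x) = x" using epred_surj by metis
  then obtain g where g: "\<forall>x\<in>#k. g x \<noteq> {#} \<and> epred (g x) = x" by blast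
  define k' where "k' = image_mset g k"
  have k'0: "{#} \<notin># k'" using g by (auto simp: k'_def)
  have "lpart k' = image_mset id k"
    unfolding lpart_limit[OF k'0] unfolding k'_def multiset.map_comp
    by (rule image_mset_cong) (use g in auto)
  then have lk': "lpart k' = k" by simp
  have "k' < M" using K[OF k(1)] lpart_less[OF k'0, of M] lk' by (cases k' M rule: linorder_cases) auto
  define N where "N n = replicate_mset n {#} + k'" for n
  have N: "N n < M" for n
    by (induction n) (use \<open>k' < M\<close> less_succ_limit[OF assms(1)] in \<open>auto simp: N_def\<close>)
  \<comment> \<open>\<open>K\<close> has fewer than 2^n terms, none above \<omega>^k, so \<omega>^k
    2^n exceeds it.\<close>
  obtain n where n: "size K < 2 ^ n" using less_exp by blast
  have "pow2 (N n) = replicate_mset (2 ^ n) k"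
  proof -
    have f0: "filter_mset (\<lambda>f. f \<noteq> {#}) (replicate_mset n {#}) = {#}"
      by (rule multiset_eqI) auto
    have "lpart (N n) = lpart k'" unfolding lpart_def N_def filter_union_mset f0 by simp
    moreover have "count (N n) {#} = n" using k'0 by (simp add: N_def not_in_iff)
    ultimately show ?thesis by (simp add: pow2_def lk')
  qed
  moreover have "K < replicate_mset (2 ^ n) k"
    using k(2) n count_le_size[of K k] by (intro less_replicate_mset) auto
  ultimately show ?thesis using N by metis
qed

section \<open>Monotonicity and binary expansions\<close>

lemma pow2_less: "N < M \<Longrightarrow> pow2 N < pow2 M"
proof (induction M rule: less_induct)
  case (less M)
  show ?case
  proof (cases M rule: limit_cases)
    case (succ M')
    then have "N \<le> M'" using less.prems less_succ_iff[OF less_eq_multiset_empty_left, of N M'] by simp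
    then have "pow2 N \<le> pow2 M'" using less.IH[of M'] succ by (auto simp: le_less le_multiset_right_total)
    also have "pow2 M' < pow2 M" by (simp add: succ)
    finally show ?thesis .
  next
    case limit
    then show ?thesis using sum_pow2_less_limit[of M "{()}" "\<lambda>_. N"] less.prems by simp
  qed (use less.prems in auto)
qed

text \<open>Split off the largest exponent m: the others sum to less than 2^m by induction, so the
  total is below 2^m + 2^m = 2^(m+1) \<le> 2^M.\<close>

lemma sum_pow2_less:
  assumes "finite S" "\<And>N. N \<in> S \<Longrightarrow> N < M"
  shows "(\<Sum>N\<in>S. pow2 N) < pow2 M"
  using assms
proof (induction "card S" arbitrary: S M)
  case 0
  then show ?case by simp
next
  case (Suc n)
  define m where "m = Max S"
  have "S \<noteq> {}" using Suc.hyps by auto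
  then have m: "m \<in> S" "\<And>N. N \<in> S \<Longrightarrow> N \<le> m" using Suc.prems by (auto simp: m_def)
  have "(\<Sum>N\<in>S - {m}. pow2 N) < pow2 m"
    by (rule Suc.hyps) (use Suc m in \<open>auto simp: order.not_eq_order_implies_strict\<close>)
  then have "(\<Sum>N\<in>S. pow2 N) < pow2 (add_mset {#} m)"
    using sum.remove[OF Suc.prems(1) m(1), of pow2] by simp
  also have "add_mset {#} m \<le> M"
    using Suc.prems(2)[OF m(1)] less_succ_iff[OF less_eq_multiset_empty_left, of M m] by auto
  then have "pow2 (add_mset {#} m) \<le> pow2 M" 
    using pow2_less[of "add_mset {#} m" M] by (auto simp: le_less simp del: pow2_succ)
  finally show ?case .
qed

text \<open>Binary expansions exist. At a successor M' + 1 either K < 2^M', or 2^M' can be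
  subtracted once; at a limit a smaller power already exceeds \<open>K\<close>.\<close>

lemma less_pow2_imp_sum:
  "K < pow2 M \<Longrightarrow> \<exists>S. finite S \<and> (\<forall>N\<in>S. N < M) \<and> K = (\<Sum>N\<in>S. pow2 N)"
proof (induction M arbitrary: K rule: less_induct)
  case (less M)
  show ?case
  proof (cases M rule: limit_cases)
    case zero
    then have "K = {#}" using less.prems by (cases K) auto
    then show ?thesis by (intro exI[of _ "{}"]) simp
  next
    case (succ M')
    have M': "M' < M" by (simp add: succ)
    have "K < pow2 M' + pow2 M'" using less.prems succ by simp
    show ?thesis
    proof (cases "K < pow2 M'")
      case True
      then obtain S where "finite S" "\<forall>N\<in>S. N < M'" "K = (\<Sum>N\<in>S. pow2 N)"
        using less.IH[OF M'] by blast
      then show ?thesis using M' by (intro exI[of _ S]) auto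
    next
      case False
      \<comment> \<open>\<open>pow2 M'\<close> repeats a single exponent, and \<open>K\<close> has
        no larger one. With too few copies of it, \<open>K\<close> would lie below
        \<open>pow2 M'\<close>.\<close>
      have "pow2 M' \<subseteq># K"
      proof (rule ccontr)
        assume "\<not> ?thesis"
        then have "count K (lpart M') < 2 ^ count M' {#}"
          by (metis count_le_replicate_mset_subset_eq not_le pow2_def)
        moreover have "x \<le> lpart M'" if "x \<in># K" for x
        proof (rule ccontr)
          assume "\<not> ?thesis"
          then have "pow2 M' + pow2 M' < K"
            using that by (intro ex_gt_imp_less_multiset) (auto simp: pow2_def)
          then show False using \<open>K < pow2 M' + pow2 M'\<close> by simp
        qed
        ultimately have "K < pow2 M'" unfolding pow2_def by (rule less_replicate_mset[rotated])
        with False show False ..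
      qed
      then obtain K' where K': "K = pow2 M' + K'" by (auto simp: subset_mset.le_iff_add)
      then have "K' < pow2 M'" using \<open>K < pow2 M' + pow2 M'\<close> by simp
      then obtain S where S: "finite S" "\<forall>N\<in>S. N < M'" "K' = (\<Sum>N\<in>S. pow2 N)"
        using less.IH[OF M'] by blast
      have "K = (\<Sum>N\<in>insert M' S. pow2 N)" using S K' by auto
      moreover have "\<forall>N\<in>insert M' S. N < M" using S M' by auto
      moreover have "finite (insert M' S)" using S(1) by simp
      ultimately show ?thesis by (intro exI[of _ "insert M' S"] conjI)
    qed
  next
    case limit
    then obtain N where N: "N < M" "K < pow2 N" using pow2_sup less.prems by blast
    then obtain S where "finite S" "\<forall>L\<in>S. L < N" "K = (\<Sum>N\<in>S. pow2 N)"
      using less.IH[OF N] by blast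
    then show ?thesis using N(1) by (intro exI[of _ S]) auto
  qed
qed

text \<open>\<open>twopow\<close> compares finite sets of positions like binary numerals, at the
  highest differing digit. The isomorphism evaluates the numeral.\<close>

lemma ordIso_twopow:
  fixes a :: "'a::wellorder"
  shows "(ordR (pow2 (val a)), twopow a) \<in> ordIso"
proof (rule ordIso_ordRI)
  let ?g = "\<lambda>z::'a. pow2 (val z)"
  let ?f = "\<lambda>S. \<Sum>z\<in>S. ?g z"
  have F: "Field (twopow a) = {S. finite S \<and> S \<subseteq> {z. z < a}}"
    by (auto simp: twopow_def Field_def)
  have inj: "inj_on val S" for S :: "'a set"
    by (rule inj_on_subset[OF strict_mono_imp_inj_on[OF strict_mono_val] subset_UNIV])
  have sum_val: "?f S = (\<Sum>N\<in>val ` S. pow2 N)" for S by (simp add: sum.reindex[OF inj] o_def)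
  have small: "?f S < ?g z" if "finite S" "\<And>y. y \<in> S \<Longrightarrow> y < z" for S z
    unfolding sum_val by (rule sum_pow2_less) (use that in auto)
  have less: "?f S < ?f T" if "finite S" "finite T" "Max ((S - T) \<union> (T - S)) \<in> T" "S \<noteq> T" for S T
  proof -
    let ?D = "(S - T) \<union> (T - S)"
    define z where "z = Max ?D"
    have "z \<in> ?D" unfolding z_def by (rule Max_in) (use that in auto)
    then have z: "z \<in> T - S" using that by (simp add: z_def)
    have "?f (S - T) < ?g z"
    proof (rule small)
      fix y assume y: "y \<in> S - T"
      then have "y \<le> z" unfolding z_def by (intro Max_ge) (use that in auto)
      then show "y < z" using y z by (auto simp: le_less)
    qed (use that in simp)
    also have "?g z \<le> ?f (T - S)"
      using sum.remove[of "T - S" z ?g] z that by (simp add: subset_eq_imp_le_multiset)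
    finally have "?f (S \<inter> T) + ?f (S - T) < ?f (T \<inter> S) + ?f (T - S)" by (simp add: Int_commute)
    then show ?thesis using that by (simp add: sum.Int_Diff[symmetric])
  qed
  show ord: "(S, T) \<in> twopow a \<longleftrightarrow> ?f S \<le> ?f T" if ST: "S \<in> Field (twopow a)" "T \<in> Field (twopow a)" for S T
  proof (cases "S = T")
    case True
    then show ?thesis using ST unfolding F by (simp add: twopow_def)
  next
    case False
    let ?D = "(S - T) \<union> (T - S)"
    have fin: "finite S" "finite T" using ST by (auto simp: F)
    have "Max ?D \<in> ?D" by (rule Max_in) (use fin False in auto)
    have mem: "(S, T) \<in> twopow a \<longleftrightarrow> Max ?D \<in> T"
      using ST[unfolded F] False unfolding twopow_def by blast
    show ?thesis
    proof (cases "Max ?D \<in> T")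
      case True
      then show ?thesis using less[OF fin True False] mem by simp
    next
      case no: False
      then have "Max ((T - S) \<union> (S - T)) \<in> S" using \<open>Max ?D \<in> ?D\<close> by (metis DiffE UnE Un_commute)
      then have "?f T < ?f S" using less[OF fin(2,1)] False by simp
      then show ?thesis using mem no by simp
    qed
  qed
  have "inj_on ?f (Field (twopow a))"
  proof (rule inj_onI)
    fix S T assume "S \<in> Field (twopow a)" "T \<in> Field (twopow a)" "?f S = ?f T"
    then have "(S, T) \<in> twopow a" "(T, S) \<in> twopow a" using ord by auto
    then have ST: "(S, T) \<in> twopow a" "(T, S) \<in> twopow a" by blast+
    show "S = T"
    proof (rule ccontr)
      let ?D = "(S - T) \<union> (T - S)"
      assume "S \<noteq> T"
      then have "Max ?D \<in> T" "Max ((T - S) \<union> (S - T)) \<in> S"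
        using ST unfolding twopow_def by blast+
      moreover have "Max ?D \<in> ?D" by (rule Max_in) (use ST \<open>S \<noteq> T\<close> in \<open>auto simp: twopow_def\<close>)
      ultimately show False by (metis DiffE UnE Un_commute)
    qed
  qed
  moreover have "?f ` Field (twopow a) = {K. K < pow2 (val a)}"
  proof
    show "?f ` Field (twopow a) \<subseteq> {K. K < pow2 (val a)}" using small by (auto simp: F)
    show "{K. K < pow2 (val a)} \<subseteq> ?f ` Field (twopow a)"
    proof clarify
      fix K assume "K < pow2 (val a)"
      then obtain S where S: "finite S" "\<forall>N\<in>S. N < val a" "K = (\<Sum>N\<in>S. pow2 N)"
        using less_pow2_imp_sum by blast
      then have "S \<subseteq> val ` {z. z < a}" using val_initial by blast
      then obtain T where T: "T \<subseteq> {z. z < a}" "S = val ` T" by (auto simp: subset_image_iff)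
      then have "finite T" using S(1) finite_imageD[OF _ inj] by simp
      then have "T \<in> Field (twopow a)" using T F by simp
      moreover have "K = ?f T" unfolding sum_val using S T by simp
      ultimately show "K \<in> ?f ` Field (twopow a)" by blast
    qed
  qed
  ultimately show "bij_betw ?f (Field (twopow a)) {K. K < pow2 (val a)}" by (simp add: bij_betw_def)
qed

section \<open>Finite subsets: upper bound\<close>

definition hoare :: "('x \<Rightarrow> 'x \<Rightarrow> bool) \<Rightarrow> 'x set \<Rightarrow> 'x set \<Rightarrow> bool" where
  "hoare le S T \<longleftrightarrow> (\<forall>x\<in>S. \<exists>y\<in>T. le x y)"

definition fsets :: "'x set \<Rightarrow> 'x set set" where
  "fsets X = {S. finite S \<and> S \<subseteq> X}"

lemma Pf_eq: "Pf A = (fsets (fst A), hoare (snd A))"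
  by (simp add: Pf_def fsets_def hoare_def fun_eq_iff)

definition po_on :: "'x set \<Rightarrow> ('x \<Rightarrow> 'x \<Rightarrow> bool) \<Rightarrow> bool" where
  "po_on X le \<longleftrightarrow> (\<forall>x\<in>X. le x x) \<and> (\<forall>x\<in>X. \<forall>y\<in>X. le x y \<and> le y x \<longrightarrow> x = y) \<and>
     (\<forall>x\<in>X. \<forall>y\<in>X. \<forall>z\<in>X. le x y \<and> le y z \<longrightarrow> le x z)"

lemma po_onI:
  assumes "\<And>x. x \<in> X \<Longrightarrow> le x x" "\<And>x y. x \<in> X \<Longrightarrow> y \<in> X \<Longrightarrow> le x y \<Longrightarrow> le y x \<Longrightarrow> x = y"
    "\<And>x y z. x \<in> X \<Longrightarrow> y \<in> X \<Longrightarrow> z \<in> X \<Longrightarrow> le x y \<Longrightarrow> le y z \<Longrightarrow> le x z"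
  shows "po_on X le"
  unfolding po_on_def using assms by blast

lemma po_on_refl: "po_on X le \<Longrightarrow> x \<in> X \<Longrightarrow> le x x"
  and po_on_antisym: "po_on X le \<Longrightarrow> x \<in> X \<Longrightarrow> y \<in> X \<Longrightarrow> le x y \<Longrightarrow> le y x \<Longrightarrow> x = y"
  and po_on_trans: "po_on X le \<Longrightarrow> x \<in> X \<Longrightarrow> y \<in> X \<Longrightarrow> z \<in> X \<Longrightarrow> le x y \<Longrightarrow> le y z \<Longrightarrow> le x z"
  unfolding po_on_def by blast+

lemma po_on_subset: "po_on X le \<Longrightarrow> Y \<subseteq> X \<Longrightarrow> po_on Y le"
  unfolding po_on_def by blast

lemma rank_le_succ_cases:
  fixes M :: "'b::wellorder multiset multiset"
  assumes po: "po_on X le" and rank: "rank_le (bad le) X (add_mset {#} M)"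
  shows "rank_le (bad le) X M \<or> (\<exists>x\<in>X. rank_le (bad le) (X - {x}) M)"
proof (rule disjCI)
  assume "\<not> (\<exists>x\<in>X. rank_le (bad le) (X - {x}) M)"
  have res: "rank_le (bad le) {y \<in> X. \<not> le x y} M" if "x \<in> X" for x
    using rank_leD[OF rank that] less_succ_iff[OF less_eq_multiset_empty_left]
    by (meson order_refl rank_le_mono)
  show "rank_le (bad le) X M"
  proof (rule rank_leI, rule ccontr)
    fix x assume x: "x \<in> X" and no: "\<not> (\<exists>K<M. rank_le (bad le) {y \<in> X. \<not> le x y} K)"
    \<comment> \<open>If \<open>y\<close> were strictly above \<open>x\<close>, the residual of \<open>y\<close> would contain \<open>x\<close> and hence have rank at least \<open>M + 1\<close>.\<close>
    have max: "y = x" if y: "y \<in> X" "le x y" for y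
    proof (rule ccontr)
      assume "y \<noteq> x"
      then have "x \<in> {z \<in> X. \<not> le y z}" using x y po_on_antisym[OF po] by blast
      then obtain K where K: "K < M" "rank_le (bad le) {z \<in> {z \<in> X. \<not> le y z}. \<not> le x z} K"
        using rank_leD[OF res[OF y(1)]] by blast
      have "rank_le (bad le) {z \<in> X. \<not> le x z} K"
        by (rule rank_le_mono[OF K(2) _ order_refl]) (use po_on_trans[OF po] x y in blast)
      with K(1) no show False by blast
    qed
    have "rank_le (bad le) (X - {x}) M"
      by (rule rank_le_mono[OF res[OF x] _ order_refl]) (use max in blast)
    then show False using x \<open>\<not> (\<exists>x\<in>X. rank_le (bad le) (X - {x}) M)\<close> by blast
  qed
qed

text \<open>At a successor M' + 1 each piece of the residual of a set may have bound 2^M', and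
  several of them need not sum to less than 2^M' + 2^M'. There the whole family of finite subsets is
  split by membership of one point instead.\<close>

lemma rank_le_fsets:
  assumes "po_on X le" "rank_le (bad le) X M"
  shows "rank_le (bad (hoare le)) (fsets X) (pow2 M)"
  using assms
proof (induction M arbitrary: X rule: less_induct)
  case (less M)
  show ?case
  proof (cases M rule: limit_cases)
    case zero
    then have "X = {}" using less.prems(2) by (metis all_not_in_conv le_multiset_empty_right rank_leD)
    then have "fsets X = {{}}" by (auto simp: fsets_def)
    then show ?thesis using zero by (auto intro!: rank_le_singleton simp: hoare_def)
  next
    case (succ M')
    then have M': "M' < M" by simp
    have "rank_le (bad le) X M' \<or> (\<exists>x\<in>X. rank_le (bad le) (X - {x}) M')"
      by (rule rank_le_succ_cases) (use less.prems succ in auto)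
    then show ?thesis
    proof
      assume "rank_le (bad le) X M'"
      then have "rank_le (bad (hoare le)) (fsets X) (pow2 M')" using less M' by blast
      then show ?thesis by (rule rank_le_mono) (use pow2_less[OF M'] in auto)
    next
      assume "\<exists>x\<in>X. rank_le (bad le) (X - {x}) M'"
      then obtain x where x: "x \<in> X" "rank_le (bad le) (X - {x}) M'" by blast
      have *: "rank_le (bad (hoare le)) (fsets (X - {x})) (pow2 M')"
        by (rule less.IH[OF M' _ x(2)]) (rule po_on_subset[OF less.prems(1)], auto)
      have "rank_le (bad (hoare le)) {S \<in> fsets X. x \<in> S} (pow2 M')"
      \<comment> \<open>As x lies in T, S - {x} \<le> T - {x} would imply S \<le> T; so deleting x
        keeps bad sequences bad.\<close>
      proof (rule rank_le_map[OF * order_refl, where f = "\<lambda>S. S - {x}"])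
        fix S T assume "S \<in> {S \<in> fsets X. x \<in> S}" "T \<in> {S \<in> fsets X. x \<in> S}"
          and "\<not> hoare le S T"
        then show "\<not> hoare le (S - {x}) (T - {x})"
          using po_on_refl[OF less.prems(1) x(1)] unfolding hoare_def by blast
      qed (auto simp: fsets_def)
      with * have "rank_le (bad (hoare le)) (fsets (X - {x}) \<union> {S \<in> fsets X. x \<in> S}) (pow2 M' + pow2 M')"
        by (rule rank_le_Un)
      then show ?thesis unfolding succ pow2_succ by (rule rank_le_mono) (auto simp: fsets_def)
    qed
  next
    case limit
    show ?thesis
    proof (rule rank_leI)
      fix S assume S: "S \<in> fsets X"
      have "\<exists>K. \<forall>s\<in>S. K s < M \<and> rank_le (bad le) {y \<in> X. \<not> le s y} (K s)"
        using S rank_leD[OF less.prems(2)] by (intro bchoice) (auto simp: fsets_def)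
      then obtain K where K: "\<And>s. s \<in> S \<Longrightarrow> K s < M"
        "\<And>s. s \<in> S \<Longrightarrow> rank_le (bad le) {y \<in> X. \<not> le s y} (K s)" by blast
      have "rank_le (bad (hoare le)) (\<Union>s\<in>S. fsets {y \<in> X. \<not> le s y}) (\<Sum>s\<in>S. pow2 (K s))"
      proof (rule rank_le_UN)
        show "finite S" using S by (simp add: fsets_def)
        fix s assume s: "s \<in> S"
        show "rank_le (bad (hoare le)) (fsets {y \<in> X. \<not> le s y}) (pow2 (K s))"
          by (rule less.IH[OF K(1)[OF s] _ K(2)[OF s]]) (rule po_on_subset[OF less.prems(1)], auto)
      qed
      then have "rank_le (bad (hoare le)) {T \<in> fsets X. \<not> hoare le S T} (\<Sum>s\<in>S. pow2 (K s))"
        by (rule rank_le_mono) (auto simp: fsets_def hoare_def)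
      moreover have "(\<Sum>s\<in>S. pow2 (K s)) < pow2 M"
        by (rule sum_pow2_less_limit[OF limit(2)]) (rule K(1))
      ultimately show "\<exists>M'<pow2 M. rank_le (bad (hoare le)) {T \<in> fsets X. \<not> hoare le S T} M'"
        by blast
    qed
  qed
qed

section \<open>The indecomposable orders\<close>

lemma sum_singleton_mset: "finite S \<Longrightarrow> (\<Sum>x\<in>S. {#m#}) = replicate_mset (card S) m"
  by (induction S rule: finite_induct) auto

lemma rank_ge_antichain:
  fixes m :: "'b::wellorder"
  assumes "finite X" "\<And>x y. x \<in> X \<Longrightarrow> y \<in> X \<Longrightarrow> x \<noteq> y \<Longrightarrow> R x y" "\<And>y. \<not> y < m"
  shows "rank_ge R X (replicate_mset (card X) m)"
proof -
  have "rank_ge R (\<Union>x\<in>X. {x}) (\<Sum>x\<in>X. {#m#})"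
    by (rule rank_ge_UN) (use assms in \<open>auto intro: rank_ge_nonempty\<close>)
  then show ?thesis using assms(1) by (simp add: sum_singleton_mset)
qed

lemma less_omega:
  fixes M :: "'b::wellorder multiset multiset"
  assumes "M < {#{#e#}#}" "\<And>y. \<not> y < e"
  shows "M = replicate_mset (size M) {#}"
proof -
  have "x = {#}" if "x \<in># M" for x using assms that by (cases x) auto
  then have "set_mset M \<subseteq> {{#}}" by auto
  then show ?thesis by (metis set_mset_subset_singletonD)
qed

lemma rank_ge_omega:
  assumes "\<And>y::'b::wellorder. \<not> y < e"
    "\<And>n. \<exists>Y\<subseteq>X. finite Y \<and> card Y = n \<and> (\<forall>x\<in>Y. \<forall>y\<in>Y. x \<noteq> y \<longrightarrow> R x y)"
  shows "rank_ge R X {#{#e#}#}"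
proof (rule rank_ge_sup)
  fix M :: "'b multiset multiset" assume "M < {#{#e#}#}"
  then have M: "M = replicate_mset (size M) {#}" using less_omega assms(1) by blast
  obtain Y where Y: "Y \<subseteq> X" "finite Y" "card Y = Suc (size M)" "\<forall>x\<in>Y. \<forall>y\<in>Y. x \<noteq> y \<longrightarrow> R x y"
    using assms(2)[of "Suc (size M)"] by blast
  have "rank_ge R Y (replicate_mset (card Y) {#} :: 'b multiset multiset)"
    by (rule rank_ge_antichain) (use Y in auto)
  then have "rank_ge R X (replicate_mset (card Y) {#} :: 'b multiset multiset)"
    by (rule rank_ge_mono) (use Y in auto)
  moreover have "M < replicate_mset (card Y) {#}"
    by (subst M) (simp add: Y(3) le_multiset_right_total)
  ultimately show "\<exists>N>M. rank_ge R X N" by blast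
qed

text \<open>Not the up-closure of \<open>F\<close>, but the complement of its down-closure.\<close>

definition upset :: "'x qo \<Rightarrow> 'x set \<Rightarrow> 'x set" where
  "upset A F = {x \<in> fst A. \<forall>y\<in>F. \<not> snd A x y}"

text \<open>\<open>A\<close> has rank \<open>\<omega>^g\<close>, and the lower bounds on the widths of \<open>A\<close> and of its finite subsets
  survive the deletion of the down-closure of a finite set. This fails for \<open>g = 0\<close>.\<close>

definition rich :: "'x qo \<Rightarrow> 'a::wellorder multiset \<Rightarrow> bool" where
  "rich A g \<longleftrightarrow> po_on (fst A) (snd A) \<and> rank_le (bad (snd A)) (fst A) {#g#} \<and>
     (\<forall>F. finite F \<and> F \<subseteq> fst A \<longrightarrow>
        rank_ge (inc (snd A)) (upset A F) {#g#} \<and>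
        rank_ge (inc (hoare (snd A))) (fsets (upset A F)) {#{#epred g#}#})"

lemma rich_po: "rich A g \<Longrightarrow> po_on (fst A) (snd A)"
  and rich_le: "rich A g \<Longrightarrow> rank_le (bad (snd A)) (fst A) {#g#}"
  and rich_ge_upset: "rich A g \<Longrightarrow> finite F \<Longrightarrow> F \<subseteq> fst A \<Longrightarrow> rank_ge (inc (snd A)) (upset A F) {#g#}"
  and rich_ge_fsets_upset: "rich A g \<Longrightarrow> finite F \<Longrightarrow> F \<subseteq> fst A \<Longrightarrow>
    rank_ge (inc (hoare (snd A))) (fsets (upset A F)) {#{#epred g#}#}"
  unfolding rich_def by blast+

lemma upset_empty [simp]: "upset A {} = fst A"
  by (simp add: upset_def)

lemma rich_ge: "rich A g \<Longrightarrow> rank_ge (inc (snd A)) (fst A) {#g#}"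
  using rich_ge_upset[of A g "{}"] by simp

lemma rich_ge_fsets: "rich A g \<Longrightarrow> rank_ge (inc (hoare (snd A))) (fsets (fst A)) {#{#epred g#}#}"
  using rich_ge_fsets_upset[of A g "{}"] by simp

lemma rich_iso:
  assumes rich: "rich A g" and bij: "bij_betw h (fst A) (fst A')"
    and ord: "\<And>x y. x \<in> fst A \<Longrightarrow> y \<in> fst A \<Longrightarrow> snd A' (h x) (h y) \<longleftrightarrow> snd A x y"
  shows "rich A' g"
  unfolding rich_def
proof (intro conjI allI impI)
  have A': "fst A' = h ` fst A" using bij by (simp add: bij_betw_def)
  show "po_on (fst A') (snd A')"
    unfolding A'
  proof (rule po_onI)
    fix x assume "x \<in> h ` fst A"
    then show "snd A' x x" using ord po_on_refl[OF rich_po[OF rich]] by auto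
  next
    fix x y assume "x \<in> h ` fst A" "y \<in> h ` fst A" and le: "snd A' x y" "snd A' y x"
    then obtain u v where "u \<in> fst A" "v \<in> fst A" "x = h u" "y = h v" by blast
    then show "x = y" using le ord po_on_antisym[OF rich_po[OF rich], of u v] by simp
  next
    fix x y z assume "x \<in> h ` fst A" "y \<in> h ` fst A" "z \<in> h ` fst A" and le: "snd A' x y" "snd A' y z"
    then obtain u v w where "u \<in> fst A" "v \<in> fst A" "w \<in> fst A" "x = h u" "y = h v" "z = h w" by blast
    then show "snd A' x z" using le ord po_on_trans[OF rich_po[OF rich], of u v w] by simp
  qed
  let ?k = "inv_into (fst A) h"
  have k: "?k y \<in> fst A" "h (?k y) = y" if "y \<in> fst A'" for y
    using that unfolding A' by (auto simp: inv_into_into f_inv_into_f)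
  show "rank_le (bad (snd A')) (fst A') {#g#}"
    by (rule rank_le_map[OF rich_le[OF rich] order_refl, where f = ?k])
      (use k ord in \<open>auto, metis\<close>)
  fix F assume F: "finite F \<and> F \<subseteq> fst A'"
  have kF: "finite (?k ` F)" "?k ` F \<subseteq> fst A" using F k by auto
  have up: "h ` upset A (?k ` F) \<subseteq> upset A' F"
  proof clarify
    fix x assume x: "x \<in> upset A (?k ` F)"
    have "\<not> snd A' (h x) y" if "y \<in> F" for y
      using x that F k[of y] ord[of x "?k y"] by (auto simp: upset_def)
    then show "h x \<in> upset A' F" using x unfolding A' by (auto simp: upset_def A')
  qed
  have sub: "upset A (?k ` F) \<subseteq> fst A" by (auto simp: upset_def)
  show "rank_ge (inc (snd A')) (upset A' F) {#g#}"
    by (rule rank_ge_map[OF rich_ge_upset[OF rich kF] order_refl up]) (use sub ord in blast)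
  show "rank_ge (inc (hoare (snd A'))) (fsets (upset A' F)) {#{#epred g#}#}"
  proof (rule rank_ge_map[OF rich_ge_fsets_upset[OF rich kF] order_refl, where f = "image h"])
    show "image h ` fsets (upset A (?k ` F)) \<subseteq> fsets (upset A' F)"
      using up by (auto simp: fsets_def)
    have "hoare (snd A') (h ` S) (h ` T) \<longleftrightarrow> hoare (snd A) S T"
      if "S \<in> fsets (upset A (?k ` F))" "T \<in> fsets (upset A (?k ` F))" for S T
    proof -
      have "S \<subseteq> fst A" "T \<subseteq> fst A" using that sub by (auto simp: fsets_def)
      then have "snd A' (h x) (h y) \<longleftrightarrow> snd A x y" if "x \<in> S" "y \<in> T" for x y
        using that ord by blast
      then show ?thesis by (simp add: hoare_def)
    qed
    then show "\<And>S T. S \<in> fsets (upset A (?k ` F)) \<Longrightarrow> T \<in> fsets (upset A (?k ` F)) \<Longrightarrow>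
      inc (hoare (snd A)) S T \<Longrightarrow> inc (hoare (snd A')) (h ` S) (h ` T)" by blast
  qed
qed

text \<open>\<open>expo g\<close> is \<omega>^e with e > 0, a limit, so one b < g meets finitely
  many strict bounds: take the successor of their maximum. Counting {#} among them keeps b
  nonzero.\<close>

lemma expo_limit_bound:
  assumes g: "expo g = {#e#}" "e \<noteq> low" and K: "finite K" "\<And>k. k \<in> K \<Longrightarrow> k < expo g"
    and Z: "finite Z" "\<And>z. z \<in> Z \<Longrightarrow> z < g"
  shows "\<exists>b<g. {#} < expo b \<and> (\<forall>k\<in>K. k < expo b) \<and> (\<forall>z\<in>Z. z < b)"
proof -
  define L where "L = insert {#} (K \<union> expo ` Z)"
  have "{#} < expo g" by (simp add: g(1))
  moreover have "expo z < expo g" if "z \<in> Z" for z using Z(2)[OF that] by simp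
  ultimately have L: "finite L" "\<And>k. k \<in> L \<Longrightarrow> k < expo g"
    unfolding L_def using K Z(1) by blast+
  define k0 where "k0 = Max L"
  have "L \<noteq> {}" by (simp add: L_def)
  then have k0: "k0 \<in> L" "\<And>k. k \<in> L \<Longrightarrow> k \<le> k0"
    using L(1) unfolding k0_def by (simp_all del: Max_insert)
  have "low < e" using g(2) by (metis low_le order.not_eq_order_implies_strict)
  then have "add_mset low k0 < expo g" using L(2)[OF k0(1)] by (simp add: g(1))
  then obtain b where b: "b < g" "add_mset low k0 = expo b" using expo_initial by blast
  have less: "k < expo b" if "k \<in> L" for k
    using k0(2)[OF that] b(2) le_multiset_right_total[of k0 low] by (metis le_less_trans)
  have "z < b" if "z \<in> Z" for z using less[of "expo z"] that by (simp add: L_def)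
  then show ?thesis using less b(1) by (auto simp: L_def)
qed

text \<open>The invariant of the recursion. For g = 0 stability under deletion is dropped: the
  one-point order does not survive the loss of its point.\<close>

definition ranked :: "'x qo \<Rightarrow> 'a::wellorder multiset \<Rightarrow> bool" where
  "ranked A g \<longleftrightarrow> po_on (fst A) (snd A) \<and> rank_le (bad (snd A)) (fst A) {#g#} \<and>
     rank_ge (inc (snd A)) (fst A) {#g#} \<and> (g \<noteq> {#} \<longrightarrow> rich A g)"

lemma rich_imp_ranked: "rich A g \<Longrightarrow> ranked A g"
  by (simp add: ranked_def rich_po rich_le rich_ge)

section \<open>Lexicographic sums\<close>

lemma Sm_le_iff [simp]:
  "snd (lexsum I F) (Sm b x) (Sm c y) \<longleftrightarrow> b < c \<or> b = c \<and> snd (F b) x y"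
  by (simp add: lexsum_def)

lemma fst_lexsum: "fst (lexsum I F) = {Sm b x | b x. b \<in> I \<and> x \<in> fst (F b)}"
  by (simp add: lexsum_def)

text \<open>The residual of a point in summand c lies in that summand and the earlier ones. Both
  have bound \<omega>^(expo c), the latter by induction, and twice this power is below
  \<omega>^(expo b).\<close>

lemma rank_le_lexsum:
  fixes b :: "'a::wellorder"
  assumes "\<And>c. c < b \<Longrightarrow> rank_le (bad (snd (F c))) (fst (F c)) {#expo c#}"
  shows "rank_le (bad (snd (lexsum I F))) {Sm c x | c x. c < b \<and> x \<in> fst (F c)} {#expo b#}"
  using assms
proof (induction b rule: less_induct)
  case (less b)
  let ?R = "bad (snd (lexsum I F))"
  show ?case
  proof (rule rank_leI)
    fix u assume "u \<in> {Sm c x | c x. c < b \<and> x \<in> fst (F c)}"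
    then obtain c x where u: "u = Sm c x" "c < b" "x \<in> fst (F c)" by blast
    have "rank_le ?R {Sm c' x | c' x. c' < c \<and> x \<in> fst (F c')} {#expo c#}"
      by (rule less.IH[OF u(2)]) (use less.prems u in auto)
    moreover have "rank_le ?R (Sm c ` fst (F c)) {#expo c#}"
      by (rule rank_le_map[OF less.prems[OF u(2)] order_refl, where f = "\<lambda>u. case u of Sm _ x \<Rightarrow> x"])
        auto
    ultimately have "rank_le ?R ({Sm c' x | c' x. c' < c \<and> x \<in> fst (F c')} \<union> Sm c ` fst (F c))
        ({#expo c#} + {#expo c#})" by (rule rank_le_Un)
    then have "rank_le ?R {y \<in> {Sm c x | c x. c < b \<and> x \<in> fst (F c)}. ?R u y} ({#expo c#} + {#expo c#})"
      by (rule rank_le_mono) (use u in \<open>auto simp: not_less le_less\<close>)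
    moreover have "{#expo c#} + {#expo c#} < {#expo b#}" using u(2) by auto
    ultimately show "\<exists>M<{#expo b#}. rank_le ?R {y \<in> {Sm c x | c x. c < b \<and> x \<in> fst (F c)}. ?R u y} M"
      by blast
  qed
qed

lemma rich_lexsum:
  fixes g :: "'a::wellorder"
  assumes g: "expo g = {#e#}" "e \<noteq> low" and F: "\<And>b. b < g \<Longrightarrow> ranked (F b) (expo b)"
  shows "rich (lexsum {b. b < g} F) (expo g)"
  unfolding rich_def
proof (intro conjI allI impI)
  let ?A = "lexsum {b. b < g} F"
  have po: "po_on (fst (F b)) (snd (F b))" if "b < g" for b using F[OF that] by (simp add: ranked_def)
  show "po_on (fst ?A) (snd ?A)"
  proof (rule po_onI)
    fix x assume "x \<in> fst ?A"
    then show "snd ?A x x" by (auto simp: fst_lexsum intro: po_on_refl[OF po])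
  next
    fix x y assume "x \<in> fst ?A" "y \<in> fst ?A" "snd ?A x y" "snd ?A y x"
    then show "x = y" by (auto simp: fst_lexsum intro: po_on_antisym[OF po])
  next
    fix x y z assume "x \<in> fst ?A" "y \<in> fst ?A" "z \<in> fst ?A" "snd ?A x y" "snd ?A y z"
    then show "snd ?A x z" by (auto simp: fst_lexsum intro: po_on_trans[OF po])
  qed
  have "rank_le (bad (snd ?A)) {Sm c x | c x. c < g \<and> x \<in> fst (F c)} {#expo g#}"
    by (rule rank_le_lexsum) (use F in \<open>simp add: ranked_def\<close>)
  then show "rank_le (bad (snd ?A)) (fst ?A) {#expo g#}" by (simp add: fst_lexsum)
  fix X assume X: "finite X \<and> X \<subseteq> fst ?A"
  \<comment> \<open>Every summand with index above all of \<open>Z\<close> survives the deletion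
    entirely.\<close>
  define Z where "Z = {z. \<exists>x. Sm z x \<in> X}"
  have "Z \<subseteq> (\<lambda>u. case u of Sm z _ \<Rightarrow> z) ` X" unfolding Z_def by force
  then have finZ: "finite Z" using X finite_subset by blast
  have Z: "z < g" if "z \<in> Z" for z using that X unfolding Z_def fst_lexsum by auto
  have up: "Sm b x \<in> upset ?A X" if "b < g" "x \<in> fst (F b)" "\<forall>z\<in>Z. z < b" for b x
  proof -
    have "\<not> snd ?A (Sm b x) y" if "y \<in> X" for y
    proof -
      have "y \<in> fst ?A" using that X by blast
      then obtain z w where "y = Sm z w" by (auto simp: fst_lexsum)
      moreover from this have "z < b" using that \<open>\<forall>z\<in>Z. z < b\<close> by (auto simp: Z_def)
      ultimately show ?thesis by auto
    qed
    then show ?thesis using that by (auto simp: upset_def fst_lexsum)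
  qed
  show "rank_ge (inc (snd ?A)) (upset ?A X) {#expo g#}"
  proof (rule rank_ge_sup)
    fix M assume "M < {#expo g#}"
    then obtain b where b: "b < g" "\<forall>k\<in>set_mset M. k < expo b" "\<forall>z\<in>Z. z < b"
      using expo_limit_bound[OF g, of "set_mset M" Z] finZ Z by auto
    have "rank_ge (inc (snd (F b))) (fst (F b)) {#expo b#}" using F[OF b(1)] by (simp add: ranked_def)
    then have "rank_ge (inc (snd ?A)) (upset ?A X) {#expo b#}"
      by (rule rank_ge_map[where f = "Sm b"]) (use up b in auto)
    then show "\<exists>N>M. rank_ge (inc (snd ?A)) (upset ?A X) N" using b(2) by (intro exI[of _ "{#expo b#}"]) auto
  qed
  have eg: "epred (expo g) = expo g" using g by (simp add: epred_def)
  show "rank_ge (inc (hoare (snd ?A))) (fsets (upset ?A X)) {#{#epred (expo g)#}#}"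
  proof (rule rank_ge_sup)
    fix M assume M: "M < {#{#epred (expo g)#}#}"
    \<comment> \<open>The index b is made to exceed x + 1 rather than x, because
      \<open>epred\<close> may take 1 back from \<open>expo b\<close>.\<close>
    let ?K = "add_mset low ` (\<Union>k\<in>set_mset M. set_mset k)"
    have "low < e" using g(2) by (metis low_le order.not_eq_order_implies_strict)
    then have "k < expo g" if "k \<in> ?K" for k using M that unfolding eg by (auto simp: g(1))
    then obtain b where b: "b < g" "{#} < expo b" "\<forall>k\<in>?K. k < expo b" "\<forall>z\<in>Z. z < b"
      using expo_limit_bound[OF g, of ?K Z] finZ Z by (metis finite_UN_I finite_imageI finite_set_mset)
    have "x < epred (expo b)" if "k \<in># M" "x \<in># k" for k x
    proof -
      have "x \<le> epred (add_mset low x)" using le_epred_add[of "add_mset low x"] by simp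
      also have "\<dots> < epred (expo b)" by (rule epred_less) (use that b(3) in auto)
      finally show ?thesis .
    qed
    then have "M < {#{#epred (expo b)#}#}" by simp
    moreover have "rank_ge (inc (hoare (snd ?A))) (fsets (upset ?A X)) {#{#epred (expo b)#}#}"
    proof (rule rank_ge_map[OF _ order_refl, where f = "image (Sm b)"])
      show "rank_ge (inc (hoare (snd (F b)))) (fsets (fst (F b))) {#{#epred (expo b)#}#}"
        using F[OF b(1)] b(2) by (auto simp: ranked_def intro: rich_ge_fsets)
    qed (use up b in \<open>auto simp: fsets_def hoare_def\<close>)
    ultimately show "\<exists>N>M. rank_ge (inc (hoare (snd ?A))) (fsets (upset ?A X)) N" by blast
  qed
qed

section \<open>The order for \<omega> and the one-point order\<close>

lemma rank_le_finite:
  fixes m :: "'b::wellorder"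
  assumes "finite X" "\<And>x. x \<in> X \<Longrightarrow> \<not> R x x"
  shows "rank_le R X (replicate_mset (card X) m)"
proof -
  have "rank_le R (\<Union>x\<in>X. {x}) (\<Sum>x\<in>X. {#m#})"
    by (rule rank_le_UN) (use assms in \<open>auto intro: rank_le_singleton\<close>)
  then show ?thesis using assms(1) by (simp add: sum_singleton_mset)
qed

lemma Om_le_iff [simp]: "snd phi_omega (Om n i) (Om m j) \<longleftrightarrow> n < m \<or> n = m \<and> i = j"
  by (simp add: phi_omega_def)

lemma fst_phi_omega: "fst phi_omega = {Om n i | n i. i < n}"
  by (simp add: phi_omega_def)

lemma rich_phi_omega: "rich (phi_omega :: 'a::wellorder phi qo) {#low :: 'a#}"
  unfolding rich_def
proof (intro conjI allI impI)
  let ?A = "phi_omega :: 'a phi qo"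
  show "po_on (fst ?A) (snd ?A)"
    by (rule po_onI) (auto simp: fst_phi_omega)
  show "rank_le (bad (snd ?A)) (fst ?A) {#{#low :: 'a#}#}"
  proof (rule rank_leI)
    fix u assume "u \<in> fst ?A"
    then obtain n i where u: "u = Om n i" "i < n" by (auto simp: fst_phi_omega)
    let ?X = "{y \<in> fst ?A. \<not> snd ?A u y}"
    have "?X \<subseteq> (\<lambda>(m, j). Om m j) ` ({..n} \<times> {..n})"
      using u by (auto simp: fst_phi_omega not_less image_iff)
    then have "finite ?X" by (rule finite_subset) simp
    then have "rank_le (bad (snd ?A)) ?X (replicate_mset (card ?X) ({#} :: 'a multiset))"
      by (rule rank_le_finite) (auto simp: fst_phi_omega)
    moreover have "replicate_mset (card ?X) ({#} :: 'a multiset) < {#{#low#}#}" by simp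
    ultimately show "\<exists>M<{#{#low :: 'a#}#}. rank_le (bad (snd ?A)) ?X M" by blast
  qed
  fix F assume F: "finite F \<and> F \<subseteq> fst ?A"
  let ?Z = "{m. \<exists>j. Om m j \<in> F}"
  have "?Z \<subseteq> (\<lambda>u. case u of Om m _ \<Rightarrow> m) ` F" by force
  then have "finite ?Z" using F finite_subset by blast
  then obtain k where k: "\<And>m j. Om m j \<in> F \<Longrightarrow> m < k" using finite_nat_set_iff_bounded[of ?Z] by auto
  \<comment> \<open>Levels are shifted by k past those meeting \<open>F\<close>; n of the n + k
    points of level n + k form an antichain of size n.\<close>
  define lev :: "nat \<Rightarrow> 'a phi set" where "lev n = Om (n + k) ` {..<n}" for n
  have lev: "lev n \<subseteq> upset ?A F" "finite (lev n)" "card (lev n) = n"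
    "\<And>x y. x \<in> lev n \<Longrightarrow> y \<in> lev n \<Longrightarrow> snd ?A x y \<longleftrightarrow> x = y" for n
  proof -
    have "\<not> snd ?A (Om (n + k) i) y" if "y \<in> F" for y i
    proof -
      have "y \<in> fst ?A" using that F by blast
      then obtain m j where y: "y = Om m j" by (auto simp: fst_phi_omega)
      then have "m < n + k" using k[of m j] that by simp
      then show ?thesis using y by simp
    qed
    then show "lev n \<subseteq> upset ?A F" by (auto simp: lev_def upset_def fst_phi_omega)
    show "finite (lev n)" by (simp add: lev_def)
    show "card (lev n) = n" unfolding lev_def by (subst card_image) (auto simp: inj_on_def)
    show "\<And>x y. x \<in> lev n \<Longrightarrow> y \<in> lev n \<Longrightarrow> snd ?A x y \<longleftrightarrow> x = y" by (auto simp: lev_def)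
  qed
  show "rank_ge (inc (snd ?A)) (upset ?A F) {#{#low :: 'a#}#}"
    by (rule rank_ge_omega) (use lev in \<open>auto intro!: exI[of _ "lev _"]\<close>)
  \<comment> \<open>2^\<omega> = \<omega>, so antichains of singletons of every finite size already
    give the bound.\<close>
  have "rank_ge (inc (hoare (snd ?A))) (fsets (upset ?A F)) {#{#{#} :: 'a multiset#}#}"
  proof (rule rank_ge_omega)
    fix n
    let ?Y = "(\<lambda>x. {x}) ` lev n"
    have "?Y \<subseteq> fsets (upset ?A F)" using lev(1)[of n] by (auto simp: fsets_def)
    moreover have "card ?Y = n" using lev(3)[of n] by (subst card_image) auto
    moreover have "\<forall>x\<in>?Y. \<forall>y\<in>?Y. x \<noteq> y \<longrightarrow> inc (hoare (snd ?A)) x y"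
      using lev(4)[of _ n] by (auto simp: hoare_def)
    ultimately show "\<exists>Y\<subseteq>fsets (upset ?A F). finite Y \<and> card Y = n \<and>
        (\<forall>x\<in>Y. \<forall>y\<in>Y. x \<noteq> y \<longrightarrow> inc (hoare (snd ?A)) x y)"
      using lev(2)[of n] by blast
  qed simp
  then show "rank_ge (inc (hoare (snd ?A))) (fsets (upset ?A F)) {#{#epred {#low :: 'a#}#}#}"
    by (simp add: epred_def)
qed

lemma ranked_gamma1: "ranked (gamma 1 :: 'a::wellorder phi qo) ({#} :: 'a multiset)"
proof -
  let ?A = "gamma 1 :: 'a phi qo"
  have A: "fst ?A = {Om 1 0}" by (auto simp: gamma_def)
  have le: "snd ?A = (=)" by (simp add: gamma_def fun_eq_iff)
  show ?thesis unfolding ranked_def A le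
    by (auto intro!: po_onI rank_le_singleton rank_ge_nonempty)
qed

section \<open>Lexicographic products, listed with the most significant factor at the head\<close>

definition lexlist :: "'x qo list \<Rightarrow> 'x list qo" where
  "lexlist As = ({xs. list_all2 (\<lambda>A x. x \<in> fst A) As xs}, lexrev As)"

lemma fst_lexlist_Cons: "fst (lexlist (A # As)) = {x # xs | x xs. x \<in> fst A \<and> xs \<in> fst (lexlist As)}"
  by (auto simp: lexlist_def list_all2_Cons1)

lemma lexlist_le_Cons [simp]:
  "snd (lexlist (A # As)) (x # xs) (y # ys) \<longleftrightarrow> snd A x y \<and> (snd A y x \<longrightarrow> snd (lexlist As) xs ys)"
  by (simp add: lexlist_def)

text \<open>For nonzero \<open>G\<close> the bound is 2^(\<omega>^G N). Finite subsets of a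
  lexicographic product do not split into independent pieces globally, so the induction follows an
  antichain play in \<open>C\<close>. Fibres over incomparable points are independent, and each move
  c contributes one factor \<omega>^(\<omega>^(epred G)).\<close>

lemma rank_ge_fsets_lexlist:
  fixes N :: "'a::wellorder multiset multiset"
  assumes poA: "po_on (fst A) (snd A)" and C: "C \<subseteq> fst A" "rank_ge (inc (snd A)) C N"
    and As: "rank_ge (inc (hoare (snd (lexlist As)))) (fsets (fst (lexlist As))) {#{#epred G#}#}"
    and G: "\<forall>x\<in>#G. e \<le> x" and N: "N \<le> {#{#e#}#}"
  shows "rank_ge (inc (hoare (snd (lexlist (A # As)))))
    (fsets {x # xs | x xs. x \<in> C \<and> xs \<in> fst (lexlist As)}) {#image_mset ((+) (epred G)) N#}"
  using C N
proof (induction N arbitrary: C rule: less_induct)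
  case (less N)
  let ?le = "snd (lexlist (A # As))"
  let ?P = "\<lambda>C. {x # xs | x xs. x \<in> C \<and> xs \<in> fst (lexlist As)}"
  have G': "\<forall>x\<in>#epred G. e \<le> x" using G by (auto simp: epred_def dest: in_diffD)
  show ?case
  proof (cases N rule: limit_cases)
    case zero
    have "{} \<in> fsets (?P C)" by (simp add: fsets_def)
    then show ?thesis unfolding zero by (auto intro!: rank_ge_nonempty)
  next
    case (succ N')
    then have N': "N' < N" by simp
    then obtain c where c: "c \<in> C" "rank_ge (inc (snd A)) {y \<in> C. inc (snd A) c y} N'"
      using rank_geD[OF less.prems(2)] by blast
    let ?C = "{y \<in> C. inc (snd A) c y}"
    have le: "N' \<le> {#{#e#}#}" using N' less.prems(3) by (meson less_imp_le less_le_trans)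
    have sub: "?C \<subseteq> fst A" using less.prems(1) by blast
    have IH: "rank_ge (inc (hoare ?le)) (fsets (?P ?C)) {#image_mset ((+) (epred G)) N'#}"
      by (rule less.IH[OF N' sub c(2) le])
    have "rank_ge (inc (hoare ?le)) (fsets (?P C))
      (image_mset ((+) (image_mset ((+) (epred G)) N')) {#{#epred G#}#})"
    \<comment> \<open>Sets over c itself are the significant factor, sets over the points
      incomparable to c the other one.\<close>
    proof (rule rank_ge_lex[OF IH As order_refl, where c = "\<lambda>q p. q \<union> (#) c ` p"])
      show "\<forall>x\<in>#image_mset ((+) (epred G)) N'. epred G \<le> x"
        by (auto simp: subset_eq_imp_le_multiset)
    next
      fix q p assume "q \<in> fsets (?P ?C)" "p \<in> fsets (fst (lexlist As))"
      then show "q \<union> (#) c ` p \<in> fsets (?P C)" using c(1) by (auto simp: fsets_def)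
    next
      fix q p q' p'
      assume mem: "q \<in> fsets (?P ?C)" "p \<in> fsets (fst (lexlist As))"
        "q' \<in> fsets (?P ?C)" "p' \<in> fsets (fst (lexlist As))"
        and inc: "inc (hoare (snd (lexlist As))) p p' \<or> p = p' \<and> inc (hoare ?le) q q'"
      have cc: "snd A c c" using po_on_refl[OF poA] c(1) less.prems(1) by blast
      have *: "hoare (snd (lexlist As)) p p' \<and> hoare ?le q q'"
        if le: "hoare ?le (q \<union> (#) c ` p) (q' \<union> (#) c ` p')"
          and mem: "q \<in> fsets (?P ?C)" "q' \<in> fsets (?P ?C)" for q p q' p'
      proof
        show "hoare (snd (lexlist As)) p p'"
          unfolding hoare_def
        proof
          fix xs assume "xs \<in> p"
          then obtain v where v: "v \<in> q' \<union> (#) c ` p'" "?le (c # xs) v"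
            using le unfolding hoare_def by blast
          have "v \<notin> q'"
          proof
            assume "v \<in> q'"
            then obtain y ys where "v = y # ys" "y \<in> ?C" using mem(2) by (auto simp: fsets_def)
            then show False using v(2) by simp
          qed
          then obtain ys where "v = c # ys" "ys \<in> p'" using v(1) by blast
          then show "\<exists>ys\<in>p'. snd (lexlist As) xs ys" using v(2) cc by auto
        qed
        show "hoare ?le q q'"
          unfolding hoare_def
        proof
          fix u assume u: "u \<in> q"
          then obtain x xs where x: "u = x # xs" "x \<in> ?C" using mem(1) by (auto simp: fsets_def)
          obtain v where v: "v \<in> q' \<union> (#) c ` p'" "?le u v"
            using le u unfolding hoare_def by blast
          have "v \<notin> (#) c ` p'" using v(2) x by auto
          then show "\<exists>v\<in>q'. ?le u v" using v by blast
        qed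
      qed
      show "inc (hoare ?le) (q \<union> (#) c ` p) (q' \<union> (#) c ` p')"
        using *[of q p q' p'] *[of q' p' q p] mem inc by blast
    qed auto
    then show ?thesis by (simp add: succ)
  next
    case limit
    show ?thesis
    proof (rule rank_ge_sup)
      fix M assume M: "M < {#image_mset ((+) (epred G)) N#}"
      show "\<exists>L>M. rank_ge (inc (hoare ?le)) (fsets (?P C)) L"
      proof (cases "M = {#}")
        case True
        have "rank_ge (inc (hoare ?le)) (fsets (?P C)) {#{#} :: 'a multiset multiset#}"
          by (rule rank_ge_nonempty) (auto simp: fsets_def)
        then show ?thesis using True by (intro exI[of _ "{#{#}#}"]) auto
      next
        case False
        define k where "k = Max (set_mset M)"
        have k: "k \<in># M" "\<And>x. x \<in># M \<Longrightarrow> x \<le> k" using False by (auto simp: k_def)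
        have "k < image_mset ((+) (epred G)) N" using M k(1) by simp
        then obtain N' K where N': "N' < N" "K < {#epred G#}" "k = image_mset ((+) (epred G)) N' + K"
          using less_image_add_cases[OF _ less.prems(3) G'] by blast
        \<comment> \<open>One more than the quotient outweighs the remainder \<open>K\<close> and
          still lies below the limit \<open>N\<close>.\<close>
        let ?N = "add_mset {#} N'"
        have lt: "?N < N" by (rule less_succ_limit[OF limit(2) N'(1)])
        have "k < image_mset ((+) (epred G)) ?N" using N'(2,3) by (simp add: add.commute)
        then have "M < {#image_mset ((+) (epred G)) ?N#}" using k(2) by (auto intro: le_less_trans)
        moreover have "rank_ge (inc (hoare ?le)) (fsets (?P C)) {#image_mset ((+) (epred G)) ?N#}"
        proof (rule less.IH[OF lt less.prems(1)])
          show "rank_ge (inc (snd A)) C ?N"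
            by (rule rank_ge_mono[OF less.prems(2) order_refl]) (use lt in simp)
          show "?N \<le> {#{#e#}#}" using lt less.prems(3) by (meson less_imp_le less_le_trans)
        qed
        ultimately show ?thesis by blast
      qed
    qed
  qed
qed

text \<open>Deletion is decided at the significant coordinate: if x is below no head of a deleted
  point, the entire fibre over x survives. \<open>G \<noteq> {#}\<close> lets \<open>epred\<close>
  act on \<open>G\<close> alone, by \<open>epred_add\<close>.\<close>

lemma rich_lexlist_Cons:
  assumes A: "rich A {#e#}" and As: "rich (lexlist As) G" and G: "G \<noteq> {#}" "\<forall>x\<in>#G. e \<le> x"
  shows "rich (lexlist (A # As)) (add_mset e G)"
  unfolding rich_def
proof (intro conjI allI impI)
  let ?L = "lexlist (A # As)"
  note poA = rich_po[OF A] and poAs = rich_po[OF As]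
  show "po_on (fst ?L) (snd ?L)"
  proof (rule po_onI)
    fix u assume "u \<in> fst ?L"
    then show "snd ?L u u" using po_on_refl[OF poA] po_on_refl[OF poAs] by (auto simp: fst_lexlist_Cons)
  next
    fix u v assume "u \<in> fst ?L" "v \<in> fst ?L" and le: "snd ?L u v" "snd ?L v u"
    then obtain x xs y ys where "u = x # xs" "v = y # ys" "x \<in> fst A" "y \<in> fst A"
      "xs \<in> fst (lexlist As)" "ys \<in> fst (lexlist As)" by (auto simp: fst_lexlist_Cons)
    then show "u = v" using le po_on_antisym[OF poA, of x y] po_on_antisym[OF poAs, of xs ys] by simp
  next
    fix u v w assume "u \<in> fst ?L" "v \<in> fst ?L" "w \<in> fst ?L" and le: "snd ?L u v" "snd ?L v w"
    then obtain x xs y ys z zs where uvw: "u = x # xs" "v = y # ys" "w = z # zs"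
      and mem: "x \<in> fst A" "y \<in> fst A" "z \<in> fst A"
      "xs \<in> fst (lexlist As)" "ys \<in> fst (lexlist As)" "zs \<in> fst (lexlist As)"
      by (auto simp: fst_lexlist_Cons)
    have xyz: "snd A x y" "snd A y z" using le uvw by simp_all
    then have "snd A x z" using po_on_trans[OF poA] mem by blast
    moreover have "snd (lexlist As) xs zs" if "snd A z x"
    proof -
      have "snd A y x" "snd A z y" using po_on_trans[OF poA] mem xyz that by blast+
      then show ?thesis using le uvw po_on_trans[OF poAs] mem by (metis lexlist_le_Cons)
    qed
    ultimately show "snd ?L u w" by (simp add: uvw)
  qed
  have "rank_le (bad (snd ?L)) (fst ?L) (image_mset ((+) G) {#{#e#}#})"
  proof (rule rank_le_lex[OF rich_le[OF As] rich_le[OF A], where p = hd and q = tl])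
    fix u assume "u \<in> fst ?L"
    then show "\<not> \<not> snd A (hd u) (hd u)" using po_on_refl[OF poA] by (auto simp: fst_lexlist_Cons)
  next
    fix u v assume "u \<in> fst ?L" "v \<in> fst ?L" and "\<not> snd ?L u v"
    then show "\<not> snd A (hd u) (hd v) \<or> hd u = hd v \<and> \<not> snd (lexlist As) (tl u) (tl v)"
      using po_on_antisym[OF poA] by (auto simp: fst_lexlist_Cons)
  qed (auto simp: fst_lexlist_Cons)
  then show "rank_le (bad (snd ?L)) (fst ?L) {#add_mset e G#}" by simp
  fix F assume F: "finite F \<and> F \<subseteq> fst ?L"
  define H where "H = hd ` F"
  have H: "finite H" "H \<subseteq> fst A" using F by (auto simp: H_def fst_lexlist_Cons)
  have up: "x # xs \<in> upset ?L F" if "x \<in> upset A H" "xs \<in> fst (lexlist As)" for x xs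
  proof -
    have "\<not> snd ?L (x # xs) v" if v: "v \<in> F" for v
    proof -
      have "v \<in> fst ?L" using v F by blast
      then obtain y ys where "v = y # ys" by (auto simp: fst_lexlist_Cons)
      moreover from this have "\<not> snd A x y"
        using \<open>x \<in> upset A H\<close> v by (force simp: upset_def H_def)
      ultimately show ?thesis by simp
    qed
    then show ?thesis using that by (auto simp: upset_def fst_lexlist_Cons)
  qed
  have upA: "upset A H \<subseteq> fst A" by (auto simp: upset_def)
  have "rank_ge (inc (snd ?L)) (upset ?L F) (image_mset ((+) G) {#{#e#}#})"
  proof (rule rank_ge_lex[OF rich_ge[OF As] rich_ge_upset[OF A H] order_refl G(2), where c = "\<lambda>xs x. x # xs"])
    fix xs x xs' x' assume "x \<in> upset A H"
      and "inc (snd A) x x' \<or> x = x' \<and> inc (snd (lexlist As)) xs xs'"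
    then show "inc (snd ?L) (x # xs) (x' # xs')"
      using po_on_refl[OF poA] upA by auto
  qed (use up in auto)
  then show "rank_ge (inc (snd ?L)) (upset ?L F) {#add_mset e G#}" by simp
  have "epred (G + {#e#}) = epred G + {#e#}" by (rule epred_add[OF G]) simp
  then have "rank_ge (inc (hoare (snd ?L))) (fsets {x # xs | x xs. x \<in> upset A H \<and> xs \<in> fst (lexlist As)})
      {#{#epred (add_mset e G)#}#}"
    using rank_ge_fsets_lexlist[OF poA upA rich_ge_upset[OF A H] rich_ge_fsets[OF As] G(2) order_refl]
    by simp
  then show "rank_ge (inc (hoare (snd ?L))) (fsets (upset ?L F)) {#{#epred (add_mset e G)#}#}"
    by (rule rank_ge_mono) (use up in \<open>auto simp: fsets_def\<close>)
qed

lemma rich_lexlist: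
  assumes "list_all2 (\<lambda>A e. rich A {#e#}) As es" "sorted es" "es \<noteq> []"
  shows "rich (lexlist As) (mset es)"
  using assms
proof (induction es arbitrary: As rule: list.induct)
  case (Cons e es)
  then obtain A As' where As: "As = A # As'" "rich A {#e#}" "list_all2 (\<lambda>A e. rich A {#e#}) As' es"
    by (auto simp: list_all2_Cons2)
  show ?case
  proof (cases "es = []")
    case True
    then have "As' = []" using As by simp
    have "rich (lexlist [A]) {#e#}"
      by (rule rich_iso[OF As(2), where h = "\<lambda>x. [x]"])
        (auto simp: bij_betw_def inj_on_def lexlist_def list_all2_Cons1)
    then show ?thesis using True As \<open>As' = []\<close> by simp
  next
    case False
    have "rich (lexlist As') (mset es)" using Cons.IH[OF As(3)] Cons.prems False by simp
    then have "rich (lexlist (A # As')) (add_mset e (mset es))"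
      by (rule rich_lexlist_Cons[OF As(2)]) (use False Cons.prems in auto)
    then show ?thesis using As by simp
  qed
qed simp

lemma rich_lexprod:
  fixes As :: "'a::wellorder phi qo list"
  assumes As: "list_all2 (\<lambda>A e. rich A {#e#}) As es" and es: "sorted_wrt (\<ge>) es" "es \<noteq> []"
  shows "rich (lexprod As) (mset es)"
proof -
  have "rich (lexlist (rev As)) (mset (rev es))"
    by (rule rich_lexlist) (use assms in \<open>auto simp: list_all2_rev sorted_wrt_rev\<close>)
  then have rich: "rich (lexlist (rev As)) (mset es)" by simp
  have mem: "rev xs \<in> fst (lexlist (rev As)) \<longleftrightarrow> length xs = length As \<and> (\<forall>i<length As. xs ! i \<in> fst (As ! i))"
    for xs
    unfolding lexlist_def by (auto simp: list_all2_rev list_all2_conv_all_nth[of _ As xs])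
  have img: "fst (lexprod As) = (\<lambda>xs. Pr (rev xs)) ` fst (lexlist (rev As))"
  proof (rule set_eqI)
    fix u
    have "u \<in> fst (lexprod As) \<longleftrightarrow> (\<exists>xs. u = Pr xs \<and> rev xs \<in> fst (lexlist (rev As)))"
      unfolding mem by (simp add: lexprod_def)
    also have "\<dots> \<longleftrightarrow> u \<in> (\<lambda>xs. Pr (rev xs)) ` fst (lexlist (rev As))"
      by (metis (no_types, lifting) image_iff rev_rev_ident)
    finally show "u \<in> fst (lexprod As) \<longleftrightarrow> u \<in> (\<lambda>xs. Pr (rev xs)) ` fst (lexlist (rev As))" .
  qed
  show ?thesis
    by (rule rich_iso[OF rich, where h = "\<lambda>xs. Pr (rev xs)"])
      (auto simp: bij_betw_def inj_on_def img, auto simp: lexprod_def lexlist_def)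
qed

section \<open>The recursion on exponents\<close>

lemma cut_phiw: "phiw g = phiw_step (cut phiw {(x, y). x < y} g) g"
  unfolding phiw_def by (rule wfrec[OF wf])

lemma ranked_phiw: "ranked (phiw (g :: 'a::wellorder)) (expo g)"
proof (induction g rule: less_induct)
  case (less g)
  define rec where "rec = cut (phiw :: 'a \<Rightarrow> _) {(x, y). x < y} g"
  have rec: "rec b = phiw b" if "b < g" for b using that by (simp add: rec_def cut_def)
  have step: "phiw g = phiw_step rec g" unfolding rec_def by (rule cut_phiw)
  consider "cnf g = []" | e where "cnf g = [e]" | "length (cnf g) > 1"
    by (cases "cnf g" rule: remdups_adj.cases) auto
  then show ?case
  proof cases
    case 1
    then have "expo g = {#}" using mset_cnf[of g] by simp
    moreover have "phiw g = gamma 1" using 1 by (simp add: step phiw_step_def)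
    ultimately show ?thesis using ranked_gamma1 by simp
  next
    case 2
    then have g: "expo g = {#e#}" using mset_cnf[of g] by simp
    show ?thesis
    proof (cases "e = low")
      case True
      then have "phiw g = phi_omega" using 2 by (simp add: step phiw_step_def)
      then show ?thesis using g True rich_imp_ranked[OF rich_phi_omega] by simp
    next
      case False
      then have "low < e" by (metis low_le order.not_eq_order_implies_strict)
      then have "phiw g = lexsum {b. b < g} rec" using 2 by (auto simp: step phiw_step_def)
      moreover have "rich (lexsum {b. b < g} rec) (expo g)"
        by (rule rich_lexsum[OF g False]) (use less rec in auto)
      ultimately show ?thesis by (simp add: rich_imp_ranked)
    qed
  next
    case 3
    let ?F = "\<lambda>e. rec (elem_of (omegapow e) g)"
    have "phiw g = lexprod (map ?F (cnf g))"
      using 3 by (auto simp: step phiw_step_def Let_def)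
    \<comment> \<open>The factor has index {#e#}, nonzero even when e is least, so the induction
      hypothesis provides \<open>rich\<close> and not merely the bounds.\<close>
    moreover have "rich (?F e) {#e#}" if e: "e \<in> set (cnf g)" for e
    proof -
      have "{#e#} \<subset># mset (cnf g)"
        using e 3 unfolding subset_mset_def by (auto dest: arg_cong[where f = size])
      then have "{#e#} < expo g" unfolding mset_cnf by (rule subset_imp_less_mset)
      from elem_of_omegapow[OF this] show ?thesis
        using less[of "elem_of (omegapow e) g"] rec by (auto simp: ranked_def)
    qed
    then have "list_all2 (\<lambda>A e. rich A {#e#}) (map ?F (cnf g)) (cnf g)"
      by (simp add: list_all2_conv_all_nth)
    then have "rich (lexprod (map ?F (cnf g))) (mset (cnf g))"
      by (rule rich_lexprod[OF _ sorted_cnf]) (use 3 in auto)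
    ultimately show ?thesis using mset_cnf[of g] by (simp add: rich_imp_ranked)
  qed
qed

section \<open>Disjoint unions with a finite tail\<close>

lemma rank_is_seqs_iff:
  assumes bij: "bij_betw h X Y"
    and R: "\<And>x y. x \<in> X \<Longrightarrow> y \<in> X \<Longrightarrow> R' (h x) (h y) \<longleftrightarrow> R x y"
  shows "rank_is (seqs R X) r \<longleftrightarrow> rank_is (seqs R' Y) r"
proof
  show "rank_is (seqs R X) r \<Longrightarrow> rank_is (seqs R' Y) r"
    using rank_is_seqs_transfer[where R = R and R' = R', OF bij] R by blast
  have "R (inv_into X h x) (inv_into X h y) \<longleftrightarrow> R' x y" if "x \<in> Y" "y \<in> Y" for x y
    using bij that R by (metis bij_betw_def f_inv_into_f inv_into_into)
  then show "rank_is (seqs R' Y) r \<Longrightarrow> rank_is (seqs R X) r"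
    using rank_is_seqs_transfer[where R = R' and R' = R, OF bij_betw_inv_into[OF bij]] by blast
qed

lemma bij_betw_fsets:
  assumes "bij_betw h X Y"
  shows "bij_betw (image h) (fsets X) (fsets Y)"
proof -
  have Y: "Y = h ` X" and inj: "inj_on h X" using assms by (auto simp: bij_betw_def)
  have "inj_on (image h) (fsets X)"
    by (rule inj_on_subset[OF inj_on_image_Pow[OF inj]]) (auto simp: fsets_def)
  moreover have "image h ` fsets X = fsets Y"
  proof
    show "image h ` fsets X \<subseteq> fsets Y" by (auto simp: Y fsets_def)
    show "fsets Y \<subseteq> image h ` fsets X"
    proof
      fix T assume "T \<in> fsets Y"
      then obtain S where "S \<subseteq> X" "finite S" "T = h ` S"
        unfolding Y fsets_def using finite_subset_image[of T h X] by blast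
      then show "T \<in> image h ` fsets X" by (auto simp: fsets_def)
    qed
  qed
  ultimately show ?thesis by (simp add: bij_betw_def)
qed

section \<open>Independent pieces and products with a finite order\<close>

lemma hoare_Un_disjoint:
  assumes "hoare le (q \<union> p) (q' \<union> p')" "\<And>x y. x \<in> q \<Longrightarrow> y \<in> p' \<Longrightarrow> \<not> le x y"
    "\<And>x y. x \<in> p \<Longrightarrow> y \<in> q' \<Longrightarrow> \<not> le x y"
  shows "hoare le q q' \<and> hoare le p p'"
  using assms unfolding hoare_def by blast

text \<open>A point x below everything is comparable to everything, so opening with it ends the
  play. Asking for a value L strictly between \<open>K\<close> and the limit \<open>M\<close> forces
  a different opening move.\<close>

lemma rank_ge_remove:
  fixes M :: "'o::wellorder"
  assumes rank: "rank_ge (inc le) X M" and lim: "\<And>K. K < M \<Longrightarrow> \<exists>L. K < L \<and> L < M"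
    and x: "\<And>y. y \<in> X \<Longrightarrow> le x y"
  shows "rank_ge (inc le) (X - {x}) M"
proof (rule rank_geI)
  fix K assume "K < M"
  then obtain L where L: "K < L" "L < M" using lim by blast
  obtain y where y: "y \<in> X" "rank_ge (inc le) {z \<in> X. inc le y z} L"
    using rank_geD[OF rank L(2)] by blast
  have "y \<noteq> x"
  proof
    assume "y = x"
    then have "{z \<in> X. inc le y z} = {}" using x by blast
    then have "rank_ge (inc le) {} L" using y(2) by metis
    then show False using rank_geD[OF _ L(1)] by blast
  qed
  moreover have "rank_ge (inc le) {z \<in> X - {x}. inc le y z} K"
    by (rule rank_ge_mono[OF y(2)]) (use x y(1) L in auto)
  ultimately show "\<exists>y\<in>X - {x}. rank_ge (inc le) {z \<in> X - {x}. inc le y z} K" using y(1) by blast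
qed

text \<open>Moves in one copy of \<open>Q\<close> leave deletions behind in the copies still to be
  played. They accumulate in \<open>F\<close>, which is why the assumption on \<open>Q\<close>
  speaks of every finite \<open>F\<close>.\<close>

lemma rank_ge_times_finite:
  fixes P :: "'p::order set" and d :: "'b::wellorder"
  assumes Q: "\<And>F. finite F \<Longrightarrow> F \<subseteq> Q \<Longrightarrow> rank_ge (inc le) (upset (Q, le) F) {#d#}"
    and P: "finite P" and F: "finite F" "F \<subseteq> Q"
  shows "rank_ge (inc (\<lambda>(q, p) (q', p'). le q q' \<and> p \<le> p')) (upset (Q, le) F \<times> P)
    (replicate_mset (card P) d)"
  using P F
proof (induction "card P" arbitrary: P F)
  case 0
  then show ?case by (simp add: rank_ge_empty_iff)
next
  case (Suc n)
  let ?le = "\<lambda>(q, p) (q', p'). le q q' \<and> p \<le> p'"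
  have "P \<noteq> {}" using Suc.hyps(2) by auto
  then obtain p where p: "p \<in> P" "\<And>b. b \<in> P \<Longrightarrow> p \<le> b \<Longrightarrow> p = b"
    using finite_has_maximal[OF Suc.prems(1)] by blast
  define P' where "P' = P - {p}"
  have P': "n = card P'" "finite P'" "P = insert p P'"
    using Suc.hyps(2) Suc.prems(1) p(1) by (auto simp: P'_def)
  \<comment> \<open>Play in the copy of \<open>Q\<close> over the maximal \<open>p\<close> first; each move \<open>z\<close> there only forces the
    elements below \<open>z\<close> to be avoided in the remaining copies.\<close>
  have *: "rank_ge (inc ?le) (upset (Q, le) F \<times> P' \<union> Z \<times> {p}) (replicate_mset n d + K)"
    if "rank_ge (inc le) Z K" "K \<le> {#d#}" "Z \<subseteq> Q" "finite F" "F \<subseteq> Q" for Z K F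
    using that
  proof (induction K arbitrary: Z F rule: less_induct)
    case (less K)
    let ?X = "upset (Q, le) F \<times> P' \<union> Z \<times> {p}"
    show ?case
    proof (rule rank_geI)
      fix L assume "L < replicate_mset n d + K"
      then have "L < replicate_mset n d \<or> (\<exists>K'<K. L = replicate_mset n d + K')"
        by (rule less_add_le_single_cases) (use less.prems in auto)
      then show "\<exists>x\<in>?X. rank_ge (inc ?le) {y \<in> ?X. inc ?le x y} L"
      proof
        assume L: "L < replicate_mset n d"
        have "rank_ge (inc ?le) (upset (Q, le) F \<times> P') (replicate_mset n d)"
          using Suc.hyps(1)[OF P'(1,2) less.prems(4,5)] P'(1) by simp
        then have "rank_ge (inc ?le) ?X (replicate_mset n d)" by (rule rank_ge_mono) auto
        then show ?thesis using L by (rule rank_geD)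
      next
        assume "\<exists>K'<K. L = replicate_mset n d + K'"
        then obtain K' where K': "K' < K" "L = replicate_mset n d + K'" by blast
        then obtain z where z: "z \<in> Z" "rank_ge (inc le) {y \<in> Z. inc le z y} K'"
          using rank_geD[OF less.prems(1)] by blast
        have "rank_ge (inc ?le) (upset (Q, le) (insert z F) \<times> P' \<union> {y \<in> Z. inc le z y} \<times> {p}) L"
          unfolding K'(2)
        proof (rule less.IH[OF K'(1) z(2)])
          show "K' \<le> {#d#}" using K'(1) less.prems(2) by (meson less_imp_le less_le_trans)
        qed (use less.prems z(1) in auto)
        then have "rank_ge (inc ?le) {y \<in> ?X. inc ?le (z, p) y} L"
        proof (rule rank_ge_mono)
          have "\<not> p \<le> p'" if "p' \<in> P'" for p' using p(2)[of p'] that by (auto simp: P'_def)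
          then show "upset (Q, le) (insert z F) \<times> P' \<union> {y \<in> Z. inc le z y} \<times> {p}
              \<subseteq> {y \<in> ?X. inc ?le (z, p) y}" by (auto simp: upset_def)
        qed simp
        then show ?thesis using z(1) by blast
      qed
    qed
  qed
  have "rank_ge (inc ?le) (upset (Q, le) F \<times> P' \<union> upset (Q, le) F \<times> {p}) (replicate_mset n d + {#d#})"
    by (rule *[OF Q]) (use Suc.prems in \<open>auto simp: upset_def\<close>)
  moreover have "upset (Q, le) F \<times> P' \<union> upset (Q, le) F \<times> {p} = upset (Q, le) F \<times> P"
    using P'(3) by auto
  ultimately show ?case using Suc.hyps(2)[symmetric] by simp
qed

text \<open>Listing \<open>P\<close> with maximal elements first gives a bad sequence through all of
  \<open>P\<close>.\<close>

lemma rank_ge_bad_finite: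
  fixes P :: "'p::order set" and d :: "'b::wellorder"
  assumes "finite P" "\<And>y. \<not> y < d"
  shows "rank_ge (bad (\<le>)) P (replicate_mset (card P) d)"
  using assms(1)
proof (induction "card P" arbitrary: P)
  case 0
  then show ?case by (simp add: rank_ge_empty_iff)
next
  case (Suc n)
  have "P \<noteq> {}" using Suc.hyps(2) by auto
  then obtain p where p: "p \<in> P" "\<And>b. b \<in> P \<Longrightarrow> p \<le> b \<Longrightarrow> p = b"
    using finite_has_maximal[OF Suc.prems(1)] by blast
  have IH: "rank_ge (bad (\<le>)) (P - {p}) (replicate_mset n d)"
  proof -
    have "n = card (P - {p})" using Suc.hyps(2) Suc.prems p(1) by simp
    then show ?thesis using Suc.hyps(1)[of "P - {p}"] Suc.prems by simp
  qed
  show ?case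
  proof (rule rank_geI)
    fix M assume "M < replicate_mset (card P) d"
    then have "M \<le> replicate_mset n d"
      unfolding Suc.hyps(2)[symmetric] using less_succ_iff[of d M] assms(2) by (simp add: not_less)
    then have "rank_ge (bad (\<le>)) {y \<in> P. \<not> p \<le> y} M"
      by (rule rank_ge_mono[OF IH, rotated]) (use p(2) in auto)
    then show "\<exists>x\<in>P. rank_ge (bad (\<le>)) {y \<in> P. \<not> x \<le> y} M" using p(1) by blast
  qed
qed

section \<open>Finite ordinals as multisets\<close>

lemma less_replicate_low:
  "{M. M < replicate_mset k (low :: 'a::wellorder)} = (\<lambda>j. replicate_mset j low) ` {..<k}"
proof (induction k)
  case (Suc k)
  have "{M. M < replicate_mset (Suc k) (low :: 'a)} =
      insert (replicate_mset k low) {M. M < replicate_mset k low}"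
    using less_succ_iff[OF low_le, of _ "replicate_mset k (low :: 'a)"] by (auto simp: le_less)
  then show ?case unfolding Suc.IH by (simp add: lessThan_Suc)
qed simp

lemma bij_betw_expo: "bij_betw expo {b. b < a} {M. M < expo a}"
  using expo_initial[of _ a] by (auto simp: bij_betw_def inj_on_def)

text \<open>A single exponent above 0 already puts every natural number below a.\<close>

lemma expo_finite_iff: "finite {b. b < a} \<longleftrightarrow> (\<forall>x\<in>#expo a. x = low)"
proof
  assume fin: "finite {b. b < a}"
  show "\<forall>x\<in>#expo a. x = low"
  proof (rule ballI, rule ccontr)
    fix x assume x: "x \<in># expo a" "x \<noteq> low"
    then have "low < x" by (metis low_le order.not_eq_order_implies_strict)
    have "replicate_mset n low < expo a" for n
      by (rule ex_gt_imp_less_multiset) (use x \<open>low < x\<close> in auto)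
    then have "range (\<lambda>n. replicate_mset n low) \<subseteq> {M. M < expo a}" by auto
    moreover have "finite {M. M < expo a}" using bij_betw_finite[OF bij_betw_expo] fin by blast
    ultimately have "finite (range (\<lambda>n. replicate_mset n (low :: 'a)))" by (rule finite_subset)
    moreover have "inj (\<lambda>n. replicate_mset n (low :: 'a))"
      by (rule injI) (metis size_replicate_mset)
    ultimately show False using finite_imageD infinite_UNIV_nat by blast
  qed
next
  assume "\<forall>x\<in>#expo a. x = low"
  then have "expo a = replicate_mset (size (expo a)) low"
    by (intro set_mset_subset_singletonD) auto
  then have "finite {M. M < expo a}" by (metis less_replicate_low finite_imageI finite_lessThan)
  then show "finite {b. b < a}" using bij_betw_finite[OF bij_betw_expo] by blast
qed

lemma card_expo: "finite {b. b < a} \<Longrightarrow> expo a = replicate_mset (card {b. b < a}) low"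
proof -
  assume "finite {b. b < a}"
  then have eq: "expo a = replicate_mset (size (expo a)) low"
    unfolding expo_finite_iff by (intro set_mset_subset_singletonD) auto
  have "card {b. b < a} = card {M. M < expo a}" by (rule bij_betw_same_card[OF bij_betw_expo])
  also have "\<dots> = card ((\<lambda>j. replicate_mset j (low :: 'a)) ` {..<size (expo a)})"
    by (subst eq) (simp add: less_replicate_low)
  also have "\<dots> = size (expo a)"
    by (subst card_image) (auto simp: inj_on_def dest: arg_cong[where f = size])
  finally show ?thesis using eq by simp
qed

lemma expo_low [simp]: "expo low = {#}"
  by (metis expo_initial le_multiset_empty_left not_less_low)

lemma expo_eq_empty_iff [simp]: "expo x = {#} \<longleftrightarrow> x = low"
  by (metis expo_eq_iff expo_low)

section \<open>Bounds for \<open>Phi\<close> itself\<close>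

lemma sum_nth_mset: "(\<Sum>i<length es. {#f (es ! i)#}) = image_mset f (mset es)"
  by (induction es rule: rev_induct) (simp_all add: nth_append)

lemma Dj_le_iff: "snd (Phi a) (Dj i x) (Dj j y) \<longleftrightarrow> i = j \<and> snd (map phiw (cnf a) ! i) x y"
  by (simp add: Phi_def dunion_def)

lemma fst_Phi: "fst (Phi a) = (\<Union>i<length (cnf a). Dj i ` fst (phiw (cnf a ! i)))"
  by (auto simp: Phi_def dunion_def)

lemma po_on_phiw: "po_on (fst (phiw g)) (snd (phiw g))"
  using ranked_phiw[of g] by (simp add: ranked_def)

lemma po_on_Phi: "po_on (fst (Phi a)) (snd (Phi a))"
  by (rule po_onI) (auto simp: fst_Phi Dj_le_iff intro: po_on_refl[OF po_on_phiw]
      po_on_antisym[OF po_on_phiw] po_on_trans[OF po_on_phiw])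

lemma val_eq_sum: "val a = (\<Sum>i<length (cnf a). {#expo (cnf a ! i)#})"
  by (simp add: sum_nth_mset mset_cnf val_def)

lemma rank_le_Phi: "rank_le (bad (snd (Phi a))) (fst (Phi a)) (val a)"
  unfolding val_eq_sum fst_Phi
proof (rule rank_le_UN)
  fix i assume i: "i \<in> {..<length (cnf a)}"
  have "rank_le (bad (snd (phiw (cnf a ! i)))) (fst (phiw (cnf a ! i))) {#expo (cnf a ! i)#}"
    using ranked_phiw[of "cnf a ! i"] by (simp add: ranked_def)
  then show "rank_le (bad (snd (Phi a))) (Dj i ` fst (phiw (cnf a ! i))) {#expo (cnf a ! i)#}"
    by (rule rank_le_map[where f = "\<lambda>u. case u of Dj _ x \<Rightarrow> x"]) (use i in \<open>auto simp: Dj_le_iff\<close>)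
qed simp

lemma rank_ge_Phi: "rank_ge (inc (snd (Phi a))) (fst (Phi a)) (val a)"
  unfolding val_eq_sum fst_Phi
proof (rule rank_ge_UN)
  fix i assume i: "i \<in> {..<length (cnf a)}"
  have "rank_ge (inc (snd (phiw (cnf a ! i)))) (fst (phiw (cnf a ! i))) {#expo (cnf a ! i)#}"
    using ranked_phiw[of "cnf a ! i"] by (simp add: ranked_def)
  then show "rank_ge (inc (snd (Phi a))) (Dj i ` fst (phiw (cnf a ! i))) {#expo (cnf a ! i)#}"
    by (rule rank_ge_map[where f = "Dj i"]) (use i in \<open>auto simp: Dj_le_iff\<close>)
qed (auto simp: Dj_le_iff)

lemma rank_is_bad_and_inc:
  assumes "rank_le (bad le) X m" "rank_ge (inc le) X m" "(ordR m, r) \<in> ordIso"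
  shows "rank_is (seqs (bad le) X) r \<and> rank_is (seqs (inc le) X) r"
proof
  show "rank_is (seqs (bad le) X) r"
    using assms(1) _ assms(3) by (rule rank_is_seqs) (rule rank_ge_rel_mono[OF assms(2)], blast)
  have "rank_le (inc le) X m" by (rule rank_le_map[OF assms(1) order_refl, where f = id]) auto
  then show "rank_is (seqs (inc le) X) r" using assms(2,3) by (rule rank_is_seqs)
qed

lemma sorted_split_low:
  assumes "sorted_wrt (\<ge>) (es :: 'a::wellorder list)"
  shows "\<exists>ts k. es = ts @ replicate k low \<and> low \<notin> set ts"
  using assms
proof (induction es)
  case (Cons e es)
  then obtain ts k where ts: "es = ts @ replicate k low" "low \<notin> set ts" by auto
  show ?case
  proof (cases "e = low")
    case True
    then have "\<forall>x\<in>set ts. x = low" using Cons.prems ts(1) by (auto simp: order.antisym)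
    then have "ts = []" using ts(2) by (cases ts) auto
    then show ?thesis using True ts by (intro exI[of _ "[]"] exI[of _ "Suc k"]) simp
  next
    case False
    then show ?thesis using ts by (intro exI[of _ "e # ts"] exI[of _ k]) simp
  qed
qed simp

text \<open>\<open>ts\<close> lists the exponents of the limit part of \<alpha>, and
  \<open>k\<close> is the finite remainder.\<close>

locale cnf_split =
  fixes a :: "'a::wellorder" and ts k
  assumes cnf: "cnf a = ts @ replicate k low" and low: "low \<notin> set ts"
begin

abbreviation "le \<equiv> snd (Phi a)"

lemma phiw_low: "fst (phiw low) = {Om 1 0 :: 'a phi}"
proof -
  have "cnf (low :: 'a) = []" using mset_cnf[of "low :: 'a"] by simp
  then show ?thesis by (auto simp: cut_phiw[of low] phiw_step_def gamma_def)
qed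

definition tail :: "nat set \<Rightarrow> 'a phi set" where
  "tail S = (\<lambda>i. Dj (length ts + i) (Om 1 0)) ` S"

text \<open>The limit part with the down-closure of \<open>F\<close> deleted, cut after n summands
  so that widths can be multiplied up one summand at a time.\<close>

definition head :: "nat \<Rightarrow> 'a phi set \<Rightarrow> 'a phi set" where
  "head n F = {Dj i x | i x. i < n \<and> x \<in> upset (phiw (ts ! i)) {y. Dj i y \<in> F}}"

lemma tail_in: "S \<subseteq> {..<k} \<Longrightarrow> tail S \<subseteq> fst (Phi a)"
  unfolding tail_def fst_Phi cnf by (force simp: nth_append phiw_low)

lemma head_in: "n \<le> length ts \<Longrightarrow> head n F \<subseteq> fst (Phi a)"
proof
  fix u assume n: "n \<le> length ts" and "u \<in> head n F"
  then obtain i x where "u = Dj i x" "i < n" "x \<in> fst (phiw (ts ! i))"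
    by (auto simp: head_def upset_def)
  then show "u \<in> fst (Phi a)"
    using n unfolding fst_Phi cnf by (intro UN_I[of i]) (auto simp: nth_append)
qed

lemma hoare_tail: "S \<subseteq> {..<k} \<Longrightarrow> T \<subseteq> {..<k} \<Longrightarrow> hoare le (tail S) (tail T) \<longleftrightarrow> S \<subseteq> T"
proof -
  assume S: "S \<subseteq> {..<k}" "T \<subseteq> {..<k}"
  have "le (Dj (length ts + i) (Om 1 0)) (Dj (length ts + j) (Om 1 0)) \<longleftrightarrow> i = j" if "i \<in> S" for i j
    using po_on_refl[OF po_on_phiw[of "low :: 'a"]] that S(1) by (auto simp: Dj_le_iff cnf nth_append phiw_low)
  then have "hoare le (tail S) (tail T) \<longleftrightarrow> (\<forall>i\<in>S. \<exists>j\<in>T. i = j)"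
    unfolding hoare_def tail_def by simp
  then show ?thesis by auto
qed

lemma le_head_tail:
  "x \<in> head (length ts) F \<Longrightarrow> y \<in> tail S \<Longrightarrow> \<not> le x y \<and> \<not> le y x"
  by (auto simp: head_def tail_def Dj_le_iff)

lemma val_split: "val a = image_mset expo (mset ts) + replicate_mset k {#}"
  unfolding val_def mset_cnf[of a, symmetric] cnf by simp

lemma empty_notin_image: "{#} \<notin># image_mset expo (mset ts)"
proof
  assume "{#} \<in># image_mset expo (mset ts)"
  then obtain x where "x \<in> set ts" "expo x = {#}" by auto
  then show False using low by simp
qed

lemma count_val: "count (val a) {#} = k"
  using empty_notin_image unfolding val_split not_in_iff by simp

lemma lpart_val: "lpart (val a) = image_mset (\<lambda>x. epred (expo x)) (mset ts)"
proof -
  have "filter_mset (\<lambda>f. f \<noteq> {#}) (val a) = image_mset expo (mset ts)"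
    unfolding val_split by (intro multiset_eqI) (auto simp: empty_notin_image[unfolded not_in_iff])
  then show ?thesis by (simp add: lpart_def image_mset.compositionality o_def)
qed

lemma pow2_val: "pow2 (val a) = replicate_mset (2 ^ k) (lpart (val a))"
  by (simp add: pow2_def count_val)

text \<open>Each new summand is the significant factor: its exponent is the smallest so far, as
  \<open>rank_ge_lex\<close> requires. All exponents in \<open>ts\<close> are positive, so every
  summand is \<open>rich\<close> and deleting below \<open>F\<close> does not lower the
  bound.\<close>

lemma rank_ge_head:
  assumes F: "finite F" "F \<subseteq> fst (Phi a)" and n: "n \<le> length ts"
  shows "rank_ge (inc (hoare le)) (fsets (head n F)) {#image_mset (\<lambda>x. epred (expo x)) (mset (take n ts))#}"
  using n
proof (induction n)
  case 0
  show ?case by (auto intro!: rank_ge_nonempty simp: fsets_def)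
next
  case (Suc n)
  let ?e = "ts ! n"
  let ?f = "\<lambda>x. epred (expo x)"
  have nth: "cnf a ! i = ts ! i" if "i < length ts" for i using that by (simp add: cnf nth_append)
  have ts: "sorted_wrt (\<ge>) ts" using sorted_cnf[of a] unfolding cnf by (simp add: sorted_wrt_append)
  have "?e \<noteq> low" using low Suc.prems by (metis Suc_le_lessD nth_mem)
  then have rich: "rich (phiw ?e) (expo ?e)" using ranked_phiw[of ?e] by (simp add: ranked_def)
  let ?F = "{y. Dj n y \<in> F}"
  have "?F \<subseteq> (\<lambda>u. case u of Dj _ y \<Rightarrow> y) ` F" by force
  then have "finite ?F" using F(1) finite_subset by blast
  moreover have "?F \<subseteq> fst (phiw ?e)" using F(2) nth[of n] Suc.prems by (auto simp: fst_Phi)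
  ultimately have B: "rank_ge (inc (hoare (snd (phiw ?e)))) (fsets (upset (phiw ?e) ?F)) {#{#?f ?e#}#}"
    by (rule rich_ge_fsets_upset[OF rich])
  have A: "rank_ge (inc (hoare le)) (fsets (head n F)) {#image_mset ?f (mset (take n ts))#}"
    using Suc by simp
  have "rank_ge (inc (hoare le)) (fsets (head (Suc n) F))
    (image_mset ((+) (image_mset ?f (mset (take n ts)))) {#{#?f ?e#}#})"
  proof (rule rank_ge_lex[OF A B order_refl, where c = "\<lambda>q p. q \<union> Dj n ` p"])
    have "?f ?e \<le> ?f x" if x: "x \<in> set (take n ts)" for x
    proof -
      obtain i where "i < n" "x = ts ! i" using x by (auto simp: in_set_conv_nth)
      then have "?e \<le> x" using ts Suc.prems by (auto simp: sorted_wrt_iff_nth_less)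
      then show ?thesis using epred_less[of "expo ?e" "expo x"] \<open>?e \<noteq> low\<close> by (auto simp: le_less)
    qed
    then show "\<forall>x\<in>#image_mset ?f (mset (take n ts)). ?f ?e \<le> x" by auto
  next
    fix q p assume "q \<in> fsets (head n F)" "p \<in> fsets (upset (phiw ?e) ?F)"
    then show "q \<union> Dj n ` p \<in> fsets (head (Suc n) F)" by (force simp: fsets_def head_def)
  next
    fix q p q' p'
    assume mem: "q \<in> fsets (head n F)" "q' \<in> fsets (head n F)"
      and inc: "inc (hoare (snd (phiw ?e))) p p' \<or> p = p' \<and> inc (hoare le) q q'"
    have *: "hoare le q q' \<and> hoare (snd (phiw ?e)) p p'"
      if "hoare le (q \<union> Dj n ` p) (q' \<union> Dj n ` p')" "q \<subseteq> head n F" "q' \<subseteq> head n F" for q p q' p'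
    proof -
      have inc: "\<not> le x (Dj n y) \<and> \<not> le (Dj n y) x" if "x \<in> head n F" for x y
        using that by (auto simp: head_def Dj_le_iff)
      have "hoare le q q' \<and> hoare le (Dj n ` p) (Dj n ` p')"
        by (rule hoare_Un_disjoint[OF that(1)]) (use that inc in blast)+
      then show ?thesis using nth[of n] Suc.prems by (simp add: hoare_def Dj_le_iff cnf nth_append)
    qed
    have "q \<subseteq> head n F" "q' \<subseteq> head n F" using mem by (auto simp: fsets_def)
    then show "inc (hoare le) (q \<union> Dj n ` p) (q' \<union> Dj n ` p')"
      using *[of q p q' p'] *[of q' p' q p] inc by blast
  qed auto
  then show ?case using Suc.prems by (simp add: take_Suc_conv_app_nth)
qed

lemma rank_ge_fsets_Phi:
  assumes "ts \<noteq> []"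
  shows "rank_ge (inc (hoare le)) (fsets (fst (Phi a))) (pow2 (val a))"
proof -
  let ?m = "length ts"
  let ?d = "lpart (val a)"
  \<comment> \<open>The empty set lies below every finite set, so it is taken out before
    down-closures are deleted.\<close>
  define Q where "Q = fsets (head ?m {}) - {{}}"
  have d0: "?d \<noteq> {#}" using assms by (simp add: lpart_val)
  have Q: "rank_ge (inc (hoare le)) (upset (Q, hoare le) \<F>) {#?d#}" if \<F>: "finite \<F>" "\<F> \<subseteq> Q" for \<F>
  proof -
    \<comment> \<open>Deleting points suffices: a nonempty set none of whose points is below a point
      of this union lies below no member of the family.\<close>
    let ?F = "\<Union>\<F>"
    have F: "finite ?F" "?F \<subseteq> fst (Phi a)"
      using \<F> head_in[of ?m "{}"] by (auto simp: Q_def fsets_def)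
    have "rank_ge (inc (hoare le)) (fsets (head ?m ?F)) {#?d#}"
      using rank_ge_head[OF F order_refl] by (simp add: lpart_val)
    then have "rank_ge (inc (hoare le)) (fsets (head ?m ?F) - {{}}) {#?d#}"
    proof (rule rank_ge_remove)
      fix K assume K: "K < {#?d#}"
      \<comment> \<open>\<omega>^d with d nonzero is a limit, so K + 1 is still below it.\<close>
      have "\<forall>x\<in>#add_mset {#} K. x < ?d" using K d0 by auto
      then show "\<exists>L. K < L \<and> L < {#?d#}" by (intro exI[of _ "add_mset {#} K"]) simp
    qed (simp add: hoare_def)
    moreover have "fsets (head ?m ?F) - {{}} \<subseteq> upset (Q, hoare le) \<F>"
    proof
      fix T assume T: "T \<in> fsets (head ?m ?F) - {{}}"
      then have sub: "T \<subseteq> head ?m ?F" by (simp add: fsets_def)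
      have "head ?m ?F \<subseteq> head ?m {}" by (auto simp: head_def upset_def)
      then have "T \<in> Q" using T by (auto simp: Q_def fsets_def)
      moreover have "\<not> hoare le T S" if S: "S \<in> \<F>" for S
      proof
        assume le: "hoare le T S"
        obtain t where t: "t \<in> T" using T by blast
        then obtain i x where x: "t = Dj i x" "i < ?m" "x \<in> upset (phiw (ts ! i)) {y. Dj i y \<in> ?F}"
          using sub by (auto simp: head_def)
        obtain s where s: "s \<in> S" "le t s" using le t by (auto simp: hoare_def)
        then have "s \<in> ?F" using S by blast
        then obtain j y where "s = Dj j y" using F(2) by (force simp: fst_Phi)
        then have "j = i" "snd (phiw (ts ! i)) x y" using s(2) x by (auto simp: Dj_le_iff cnf nth_append)
        then show False using x(3) \<open>s \<in> ?F\<close> \<open>s = Dj j y\<close> by (auto simp: upset_def)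
      qed
      ultimately show "T \<in> upset (Q, hoare le) \<F>" by (simp add: upset_def)
    qed
    ultimately show ?thesis by (rule rank_ge_mono) simp
  qed
  \<comment> \<open>One copy of \<open>Q\<close> for each of the 2^k subsets of the tail, which
    yields \<omega>^d 2^k = 2^\<alpha>.\<close>
  have "rank_ge (inc (\<lambda>(q, p) (q', p'). hoare le q q' \<and> p \<le> p')) (upset (Q, hoare le) {} \<times> Pow {..<k})
    (replicate_mset (card (Pow {..<k})) ?d)"
    by (rule rank_ge_times_finite) (use Q in auto)
  then have *: "rank_ge (inc (\<lambda>(q, p) (q', p'). hoare le q q' \<and> p \<subseteq> p')) (Q \<times> Pow {..<k}) (pow2 (val a))"
    by (simp add: card_Pow pow2_val)
  show ?thesis
  proof (rule rank_ge_map[OF * order_refl, where f = "\<lambda>(q, p). q \<union> tail p"])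
    have "q \<union> tail p \<in> fsets (fst (Phi a))" if "q \<in> Q" "p \<subseteq> {..<k}" for q p
      using that head_in[of ?m "{}"] tail_in[of p] finite_subset[of p "{..<k}"]
      by (auto simp: Q_def fsets_def tail_def)
    then show "(\<lambda>(q, p). q \<union> tail p) ` (Q \<times> Pow {..<k}) \<subseteq> fsets (fst (Phi a))" by auto
  next
    have *: "hoare le q q' \<and> p \<subseteq> p'"
      if "hoare le (q \<union> tail p) (q' \<union> tail p')" "q \<in> Q" "q' \<in> Q" "p \<subseteq> {..<k}" "p' \<subseteq> {..<k}" for q p q' p'
    proof -
      have "q \<subseteq> head ?m {}" "q' \<subseteq> head ?m {}" using that by (auto simp: Q_def fsets_def)
      then have "hoare le q q' \<and> hoare le (tail p) (tail p')"
        by (intro hoare_Un_disjoint[OF that(1)]) (use le_head_tail in blast)+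
      then show ?thesis using hoare_tail that by blast
    qed
    fix x y assume mem: "x \<in> Q \<times> Pow {..<k}" "y \<in> Q \<times> Pow {..<k}"
      and inc: "inc (\<lambda>(q, p) (q', p'). hoare le q q' \<and> p \<subseteq> p') x y"
    obtain q p q' p' where xy: "x = (q, p)" "y = (q', p')" by fastforce
    show "inc (hoare le) (case x of (q, p) \<Rightarrow> q \<union> tail p) (case y of (q, p) \<Rightarrow> q \<union> tail p)"
      using *[of q p q' p'] *[of q' p' q p] mem inc unfolding xy by auto
  qed
qed

text \<open>For finite \<alpha> the finite subsets form the Boolean lattice on k points, and one bad
  sequence runs through all 2^k of them.\<close>

lemma rank_ge_bad_fsets_Phi:
  assumes "ts = []"
  shows "rank_ge (bad (hoare le)) (fsets (fst (Phi a))) (pow2 (val a))"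
proof -
  have "rank_ge (bad (\<le>)) (Pow {..<k}) (replicate_mset (card (Pow {..<k})) ({#} :: 'a multiset multiset))"
    by (rule rank_ge_bad_finite) auto
  moreover have "pow2 (val a) = replicate_mset (card (Pow {..<k})) {#}"
    using assms by (simp add: pow2_val lpart_val card_Pow)
  ultimately have *: "rank_ge (bad (\<le>)) (Pow {..<k}) (pow2 (val a))" by simp
  show ?thesis
  proof (rule rank_ge_map[OF * order_refl, where f = tail])
    show "tail ` Pow {..<k} \<subseteq> fsets (fst (Phi a))"
      using tail_in finite_subset[of _ "{..<k}"] by (auto simp: fsets_def tail_def)
  qed (simp add: hoare_tail)
qed

lemma fst_Phi_finite: "ts = [] \<Longrightarrow> fst (Phi a) = tail {..<k}"
  unfolding fst_Phi tail_def cnf by (auto simp: phiw_low)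

end

theorem mainTheorem10:
  fixes a :: "'a::wellorder"
  shows "rank_is (bad_seqs (Phi a)) (ordR a)
       \<and> rank_is (antichain_seqs (Phi a)) (ordR a)
       \<and> (infinite {x. x < a} \<longrightarrow>
            rank_is (antichain_seqs (Pf (Phi a))) (twopow a)
          \<and> rank_is (bad_seqs (Pf (Phi a))) (twopow a))
       \<and> (finite {x. x < a} \<longrightarrow>
            rank_is (bad_seqs (Pf (Phi a))) (twopow a)
          \<and> (\<forall>r :: 'b rel. rank_is (antichain_seqs (Pf (Phi a))) r \<longleftrightarrow>
                rank_is (antichain_seqs (Pf (gamma (card {x. x < a}) :: 'a phi qo))) r))"
proof -
  obtain ts k where split: "cnf a = ts @ replicate k low" "low \<notin> set ts"
    using sorted_split_low[OF sorted_cnf] by blast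
  then interpret cnf_split a ts k by unfold_locales
  have upper: "rank_le (bad (hoare le)) (fsets (fst (Phi a))) (pow2 (val a))"
    by (rule rank_le_fsets[OF po_on_Phi rank_le_Phi])
  have fin: "finite {x. x < a} \<longleftrightarrow> ts = []"
    unfolding expo_finite_iff mset_cnf[symmetric] split(1) using split(2) by (cases ts) auto
  have 1: "rank_is (bad_seqs (Phi a)) (ordR a) \<and> rank_is (antichain_seqs (Phi a)) (ordR a)"
    unfolding bad_seqs_eq antichain_seqs_eq
    by (rule rank_is_bad_and_inc[OF rank_le_Phi rank_ge_Phi ordIso_val])
  have 2: "rank_is (bad_seqs (Pf (Phi a))) (twopow a) \<and> rank_is (antichain_seqs (Pf (Phi a))) (twopow a)"
    if "infinite {x. x < a}"
    unfolding bad_seqs_eq antichain_seqs_eq Pf_eq fst_conv snd_conv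
    using rank_is_bad_and_inc[OF upper rank_ge_fsets_Phi ordIso_twopow] that fin by blast
  have 3: "rank_is (bad_seqs (Pf (Phi a))) (twopow a)" if "finite {x. x < a}"
    unfolding bad_seqs_eq Pf_eq fst_conv snd_conv
    by (rule rank_is_seqs[OF upper rank_ge_bad_fsets_Phi ordIso_twopow]) (use that fin in blast)
  \<comment> \<open>\<open>Phi\<close> is here an antichain of k points, and its isomorphism with
    \<open>gamma k\<close> transports every rank of the tree of antichains.\<close>
  have 4: "rank_is (antichain_seqs (Pf (Phi a))) r \<longleftrightarrow>
      rank_is (antichain_seqs (Pf (gamma (card {x. x < a}) :: 'a phi qo))) r"
    if f: "finite {x. x < a}" for r :: "'b rel"
  proof -
    have ts: "ts = []" using f fin by simp
    have "card {x. x < a} = k"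
      using card_expo[OF f] mset_cnf[of a] split(1) ts by (metis append_Nil mset_replicate size_replicate_mset)
    let ?G = "gamma k :: 'a phi qo"
    \<comment> \<open>Each summand is a single point, so its index i serves as the label in
      \<open>gamma k\<close>.\<close>
    let ?h = "\<lambda>u. case u of Dj i x \<Rightarrow> Om k i"
    have bij: "bij_betw ?h (fst (Phi a)) (fst ?G)"
      unfolding fst_Phi_finite[OF ts] tail_def bij_betw_def
      by (auto simp: inj_on_def gamma_def image_image ts)
    have ord: "hoare (snd ?G) (?h ` S) (?h ` T) \<longleftrightarrow> hoare le S T"
      if "S \<in> fsets (fst (Phi a))" "T \<in> fsets (fst (Phi a))" for S T
    proof -
      obtain S' T' where *: "S = tail S'" "S' \<subseteq> {..<k}" "T = tail T'" "T' \<subseteq> {..<k}"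
        using \<open>S \<in> _\<close> \<open>T \<in> _\<close> unfolding fst_Phi_finite[OF ts] fsets_def tail_def
        by (auto simp: subset_image_iff)
      have "hoare (snd ?G) (?h ` S) (?h ` T) \<longleftrightarrow> S' \<subseteq> T'"
        unfolding * tail_def hoare_def by (auto simp: gamma_def ts image_image)
      then show ?thesis using * hoare_tail by simp
    qed
    show ?thesis
      unfolding \<open>card {x. x < a} = k\<close> antichain_seqs_eq Pf_eq fst_conv snd_conv
      by (rule rank_is_seqs_iff[OF bij_betw_fsets[OF bij]]) (simp add: ord)
  qed
  show ?thesis using 1 2 3 4 by blast
qed

end
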